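(* Let $K$ be a compact metric space and let $(f_n)$ be a uniformly bounded sequence in $C(K)$ which converges pointwise to a function $f$. If $f\notin D(K)$, then $(f_n)$ has a strongly summing subsequence (as a sequence in the Banach space $C(K)$ with the sup norm).
   Context: $C(K)$ is the space of continuous complex-valued functions on $K$ with the sup norm. $D(K)$ is the set of functions $f:K\to\mathbb{C}$ for which there exist bounded lower semi-continuous real functions $u_1,\dots,u_4$ on $K$ with $f=(u_1-u_2)+i(u_3-u_4)$; equivalently, there is a sequence $(\varphi_j)$ in $C(K)$ with $\sup_{k\in K}\sum_j|\varphi_j(k)|<\infty$ and $f=\sum_j\varphi_j$ pointwise. A sequence $(b_j)$ in a Banach space is strongly summing if it is a weak-Cauchy basic sequence (weak-Cauchy: $(x^*(b_j))$ converges for each functional $x^*$; basic: a Schauder basis of its closed linear span) such that whenever scalars $(c_j)$ satisfy $\sup_n\|\sum_{j=1}^n c_jb_j\|<\infty$, the series $\sum_j c_j$ converges. *)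

theory Defs
  imports "HOL-Analysis.Analysis"
begin

text \<open>Throughout, K is a subset of a metric space (compact in the theorem); elements of C(K)
are represented by functions 'a => complex that are continuous on K; only their values on K matter.\<close>

definition CK :: "'a::metric_space set \<Rightarrow> ('a \<Rightarrow> complex) set" where
  "CK K = {g. continuous_on K g}"

definition supn :: "'a::metric_space set \<Rightarrow> ('a \<Rightarrow> complex) \<Rightarrow> real" where
  "supn K g = (if K = {} then 0 else (SUP x\<in>K. norm (g x)))"

definition lsc_on :: "'a::metric_space set \<Rightarrow> ('a \<Rightarrow> real) \<Rightarrow> bool" where
  "lsc_on K u \<longleftrightarrow> (\<forall>a. openin (top_of_set K) {x\<in>K. a < u x})"

definition bounded_on :: "'a set \<Rightarrow> ('a \<Rightarrow> real) \<Rightarrow> bool" where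
  "bounded_on K u \<longleftrightarrow> (\<exists>M. \<forall>x\<in>K. \<bar>u x\<bar> \<le> M)"

definition inD :: "'a::metric_space set \<Rightarrow> ('a \<Rightarrow> complex) \<Rightarrow> bool" where
  "inD K f \<longleftrightarrow> (\<exists>u1 u2 u3 u4.
      bounded_on K u1 \<and> bounded_on K u2 \<and> bounded_on K u3 \<and> bounded_on K u4 \<and>
      lsc_on K u1 \<and> lsc_on K u2 \<and> lsc_on K u3 \<and> lsc_on K u4 \<and>
      (\<forall>x\<in>K. f x = Complex (u1 x - u2 x) (u3 x - u4 x)))"

definition dual_functional :: "'a::metric_space set \<Rightarrow> (('a \<Rightarrow> complex) \<Rightarrow> complex) \<Rightarrow> bool" where
  "dual_functional K \<phi> \<longleftrightarrow>
     (\<forall>g\<in>CK K. \<forall>h\<in>CK K. \<forall>a b. \<phi> (\<lambda>x. a * g x + b * h x) = a * \<phi> g + b * \<phi> h) \<and>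
     (\<exists>C. \<forall>g\<in>CK K. norm (\<phi> g) \<le> C * supn K g)"

definition weak_Cauchy :: "'a::metric_space set \<Rightarrow> (nat \<Rightarrow> 'a \<Rightarrow> complex) \<Rightarrow> bool" where
  "weak_Cauchy K b \<longleftrightarrow> (\<forall>\<phi>. dual_functional K \<phi> \<longrightarrow> convergent (\<lambda>j. \<phi> (b j)))"

definition psum :: "(nat \<Rightarrow> 'a \<Rightarrow> complex) \<Rightarrow> (nat \<Rightarrow> complex) \<Rightarrow> nat \<Rightarrow> 'a \<Rightarrow> complex" where
  "psum b c n = (\<lambda>x. \<Sum>j<n. c j * b j x)"

definition cspan :: "'a::metric_space set \<Rightarrow> (nat \<Rightarrow> 'a \<Rightarrow> complex) \<Rightarrow> ('a \<Rightarrow> complex) set" where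
  "cspan K b = {x \<in> CK K. \<forall>e>0. \<exists>n c. supn K (\<lambda>k. x k - psum b c n k) < e}"

definition expands :: "'a::metric_space set \<Rightarrow> (nat \<Rightarrow> 'a \<Rightarrow> complex) \<Rightarrow> (nat \<Rightarrow> complex) \<Rightarrow> ('a \<Rightarrow> complex) \<Rightarrow> bool" where
  "expands K b c x \<longleftrightarrow> (\<lambda>n. supn K (\<lambda>k. x k - psum b c n k)) \<longlonglongrightarrow> 0"

definition basic_seq :: "'a::metric_space set \<Rightarrow> (nat \<Rightarrow> 'a \<Rightarrow> complex) \<Rightarrow> bool" where
  "basic_seq K b \<longleftrightarrow> (\<forall>j. b j \<in> CK K) \<and> (\<forall>x\<in>cspan K b. \<exists>!c. expands K b c x)"

definition strongly_summing :: "'a::metric_space set \<Rightarrow> (nat \<Rightarrow> 'a \<Rightarrow> complex) \<Rightarrow> bool" where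
  "strongly_summing K b \<longleftrightarrow> weak_Cauchy K b \<and> basic_seq K b \<and>
     (\<forall>c. (\<exists>M. \<forall>n. supn K (psum b c n) \<le> M) \<longrightarrow> summable c)"

end

(* Idea: if f is real, call t_0, t_1, ..., t_k a chain when each point is chosen arbitrarily
   close to its predecessor, and let v(t) be the supremum, over all well-founded trees of such
   choices with root t, of the total increment of f along every second step. Then v and v + f are
   upper semicontinuous, so if v is bounded, f is a difference of bounded lower semicontinuous
   functions. Hence f not in D(K) provides trees with arbitrarily large increments of Re f or Im f.

   Each tree is well-founded with countable branching, so a single subsequence (b_j) handles
   all of them: at stage m only finitely many nodes are active, b_m is chosen close to f at those
   nodes, and every active node activates one child so close to it that b_0, ..., b_m do not see
   the difference. At the end of a branch with moves at times q_0 < q_1 < ..., the sequence b_j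
   stays close to f(t_i) for q_(i-1) <= j < q_i. If the partial sums of (c_j) oscillate between two
   values at the times q_i, then sum c_j b_j at that point is large. A jump of f activated at
   every stage bounds the tail sums of (c_j), which gives a basis constant. *)
theory Submission
  imports Defs
begin

section \<open>Functionals and pointwise convergence\<close>

lemma norm_le_supn:
  assumes "compact K" "continuous_on K g" "x \<in> K"
  shows "norm (g x) \<le> supn K g"
proof -
  have "compact ((\<lambda>x. norm (g x)) ` K)"
    using assms by (intro compact_continuous_image continuous_intros)
  then have "bdd_above ((\<lambda>x. norm (g x)) ` K)"
    by (intro bounded_imp_bdd_above compact_imp_bounded)
  then show ?thesis
    using assms(3) unfolding supn_def by (auto intro: cSUP_upper)
qed

lemma supn_le:
  assumes "0 \<le> B" "\<And>x. x \<in> K \<Longrightarrow> norm (g x) \<le> B"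
  shows "supn K g \<le> B"
  using assms unfolding supn_def by (auto intro: cSUP_least)

lemma supn_nonneg:
  assumes "compact K" "continuous_on K g"
  shows "0 \<le> supn K g"
proof (cases "K = {}")
  case False
  then obtain x where "x \<in> K" by blast
  then show ?thesis
    using norm_le_supn[OF assms] norm_ge_zero order_trans by blast
qed (simp add: supn_def)

text \<open>Dini's argument: the open sets where \<open>F n < e\<close> increase with
  \<open>n\<close> and cover \<open>K\<close>, so by compactness one of them is all of
  \<open>K\<close>.\<close>

lemma Dini_zero:
  fixes F :: "nat \<Rightarrow> 'a::metric_space \<Rightarrow> real"
  assumes K: "compact K" and cont: "\<And>n. continuous_on K (F n)"
    and dec: "\<And>n x. x \<in> K \<Longrightarrow> F (Suc n) x \<le> F n x"
    and lim: "\<And>x. x \<in> K \<Longrightarrow> (\<lambda>n. F n x) \<longlonglongrightarrow> 0"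
    and e: "0 < e"
  shows "\<exists>n. \<forall>x\<in>K. F n x < e"
proof -
  have op: "openin (top_of_set K) {x \<in> K. F n x < e}" for n
    using continuous_openin_preimage_gen[OF cont[of n], of "{..<e}"]
    by (auto simp: vimage_def Int_def conj_commute)
  have cov: "K \<subseteq> (\<Union>n. {x \<in> K. F n x < e})"
  proof
    fix x assume "x \<in> K"
    then have "\<forall>\<^sub>F n in sequentially. F n x < e"
      using lim e order_tendstoD(2) by blast
    then show "x \<in> (\<Union>n. {x \<in> K. F n x < e})"
      using \<open>x \<in> K\<close> by (auto simp: eventually_sequentially)
  qed
  have "\<exists>N. finite N \<and> K \<subseteq> (\<Union>n\<in>N. {x \<in> K. F n x < e})"
  proof -
    have "\<exists>D'\<subseteq>range (\<lambda>n. {x \<in> K. F n x < e}). finite D' \<and> K \<subseteq> \<Union>D'"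
      by (rule K[unfolded compact_eq_openin_cover, rule_format]) (use op cov in auto)
    then obtain D' where D': "D' \<subseteq> range (\<lambda>n. {x \<in> K. F n x < e})" "finite D'" "K \<subseteq> \<Union>D'"
      by blast
    obtain N where "finite N" "D' = (\<lambda>n. {x \<in> K. F n x < e}) ` N"
      using finite_subset_image[OF D'(2,1)] by blast
    then show ?thesis using D'(3) by blast
  qed
  then obtain N where N: "finite N" "K \<subseteq> (\<Union>n\<in>N. {x \<in> K. F n x < e})"
    by blast
  have anti: "F n x \<le> F m x" if "x \<in> K" "m \<le> n" for m n x
    using lift_Suc_antimono_le[of "\<lambda>n. F n x", OF dec[OF that(1)] that(2)] .
  obtain n where n: "\<And>m. m \<in> N \<Longrightarrow> m \<le> n"
    using N(1) by (auto simp: finite_nat_set_iff_bounded_le)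
  have "F n x < e" if x: "x \<in> K" for x
  proof -
    from x obtain m where "m \<in> N" "F m x < e" using N by blast
    then show ?thesis using anti[OF x n[of m]] by simp
  qed
  then show ?thesis by blast
qed

section \<open>Total variation of a bounded functional on real continuous functions\<close>

text \<open>When \<open>\<psi>\<close> is integration against a signed measure and \<open>u\<close>
  is continuous and nonnegative, this is the integral of \<open>u\<close> against the total
  variation measure. The supremum gives it without a representing measure.\<close>

definition variation :: "'a::metric_space set \<Rightarrow> (('a \<Rightarrow> real) \<Rightarrow> real) \<Rightarrow> ('a \<Rightarrow> real) \<Rightarrow> real" where
  "variation K \<psi> u = (SUP h\<in>{h. continuous_on K h \<and> (\<forall>x\<in>K. \<bar>h x\<bar> \<le> u x)}. \<psi> h)"

text \<open>Intended for the real and imaginary parts of a complex functional restricted to real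
  functions. \<open>bound\<close> is one-sided; together with \<open>neg\<close> it controls both
  signs.\<close>

locale bounded_real_functional =
  fixes K :: "'a::metric_space set" and \<psi> :: "('a \<Rightarrow> real) \<Rightarrow> real" and C :: real
  assumes compact: "compact K"
    and add: "\<lbrakk>continuous_on K g; continuous_on K h\<rbrakk> \<Longrightarrow> \<psi> (\<lambda>x. g x + h x) = \<psi> g + \<psi> h"
    and neg: "continuous_on K g \<Longrightarrow> \<psi> (\<lambda>x. - g x) = - \<psi> g"
    and bound: "\<lbrakk>continuous_on K g; 0 \<le> B; \<And>x. x \<in> K \<Longrightarrow> \<bar>g x\<bar> \<le> B\<rbrakk> \<Longrightarrow> \<psi> g \<le> C * B"
begin

lemma variation_upper:
  assumes u: "continuous_on K u" and h: "continuous_on K h" "\<And>x. x \<in> K \<Longrightarrow> \<bar>h x\<bar> \<le> u x"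
  shows "\<psi> h \<le> variation K \<psi> u"
proof -
  obtain B where B: "\<forall>x\<in>K. norm (u x) \<le> B"
    using compact_imp_bounded[OF compact_continuous_image[OF u compact]]
    by (auto simp: bounded_iff)
  have "bdd_above (\<psi> ` {h. continuous_on K h \<and> (\<forall>x\<in>K. \<bar>h x\<bar> \<le> u x)})"
  proof (rule bdd_aboveI2)
    fix h assume "h \<in> {h. continuous_on K h \<and> (\<forall>x\<in>K. \<bar>h x\<bar> \<le> u x)}"
    then show "\<psi> h \<le> C * max 0 B"
      using B by (intro bound) force+
  qed
  then show ?thesis
    unfolding variation_def using h by (auto intro!: cSUP_upper)
qed

lemma variation_least:
  assumes "\<And>x. x \<in> K \<Longrightarrow> 0 \<le> u x"
    and "\<And>h. \<lbrakk>continuous_on K h; \<And>x. x \<in> K \<Longrightarrow> \<bar>h x\<bar> \<le> u x\<rbrakk> \<Longrightarrow> \<psi> h \<le> b"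
  shows "variation K \<psi> u \<le> b"
  unfolding variation_def
proof (rule cSUP_least)
  have "(\<lambda>_. 0) \<in> {h. continuous_on K h \<and> (\<forall>x\<in>K. \<bar>h x\<bar> \<le> u x)}"
    using assms(1) by simp
  then show "{h. continuous_on K h \<and> (\<forall>x\<in>K. \<bar>h x\<bar> \<le> u x)} \<noteq> {}"
    by blast
qed (use assms(2) in auto)

text \<open>Functions dominated by \<open>u\<close> and \<open>v\<close> have a sum dominated by
  \<open>u + v\<close>; the two suprema are taken one after the other.\<close>

lemma variation_superadd:
  assumes u: "continuous_on K u" "\<And>x. x \<in> K \<Longrightarrow> 0 \<le> u x"
    and v: "continuous_on K v" "\<And>x. x \<in> K \<Longrightarrow> 0 \<le> v x"
  shows "variation K \<psi> u + variation K \<psi> v \<le> variation K \<psi> (\<lambda>x. u x + v x)"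
proof -
  have *: "\<psi> h + \<psi> k \<le> variation K \<psi> (\<lambda>x. u x + v x)"
    if h: "continuous_on K h" "\<And>x. x \<in> K \<Longrightarrow> \<bar>h x\<bar> \<le> u x"
      and k: "continuous_on K k" "\<And>x. x \<in> K \<Longrightarrow> \<bar>k x\<bar> \<le> v x" for h k
  proof -
    have "\<psi> (\<lambda>x. h x + k x) \<le> variation K \<psi> (\<lambda>x. u x + v x)"
    proof (rule variation_upper)
      show "\<bar>h x + k x\<bar> \<le> u x + v x" if "x \<in> K" for x
        using h(2)[OF that] k(2)[OF that] by linarith
    qed (intro continuous_intros h k u v)+
    then show ?thesis using add h k by simp
  qed
  have "variation K \<psi> v \<le> variation K \<psi> (\<lambda>x. u x + v x) - \<psi> h"
    if "continuous_on K h" "\<And>x. x \<in> K \<Longrightarrow> \<bar>h x\<bar> \<le> u x" for h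
    using *[OF that] v by (intro variation_least) (simp_all add: le_diff_eq add.commute)
  then have "variation K \<psi> u \<le> variation K \<psi> (\<lambda>x. u x + v x) - variation K \<psi> v"
    using u by (intro variation_least) (simp_all add: le_diff_eq add.commute)
  then show ?thesis by simp
qed

text \<open>A function \<open>h\<close> dominated by \<open>u + v\<close> is clipped to the range
  between \<open>- u\<close> and \<open>u\<close>; the clipped part is dominated by \<open>u\<close>
  and the remainder by \<open>v\<close>.\<close>

lemma variation_subadd:
  assumes u: "continuous_on K u" "\<And>x. x \<in> K \<Longrightarrow> 0 \<le> u x"
    and v: "continuous_on K v" "\<And>x. x \<in> K \<Longrightarrow> 0 \<le> v x"
  shows "variation K \<psi> (\<lambda>x. u x + v x) \<le> variation K \<psi> u + variation K \<psi> v"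
proof (rule variation_least)
  fix h assume h: "continuous_on K h" "\<And>x. x \<in> K \<Longrightarrow> \<bar>h x\<bar> \<le> u x + v x"
  define k where "k = (\<lambda>x. max (- u x) (min (h x) (u x)))"
  have k: "continuous_on K k"
    unfolding k_def by (intro continuous_intros u h)
  have "\<psi> k \<le> variation K \<psi> u"
    by (rule variation_upper[OF u(1) k]) (use u(2) in \<open>simp add: k_def abs_le_iff min_le_iff_disj le_max_iff_disj\<close>)
  moreover have "\<psi> (\<lambda>x. h x + - k x) \<le> variation K \<psi> v"
  proof (rule variation_upper[OF v(1)])
    show "\<bar>h x + - k x\<bar> \<le> v x" if "x \<in> K" for x
      using h(2)[OF that] u(2)[OF that] v(2)[OF that]
        unfolding k_def min_def max_def by (auto split: if_splits)
  qed (intro continuous_intros h k)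
  moreover have "\<psi> (\<lambda>x. h x + - k x) = \<psi> h - \<psi> k"
    using add[OF h(1), of "\<lambda>x. - k x"] neg[OF k] k by (simp add: continuous_on_minus)
  ultimately show "\<psi> h \<le> variation K \<psi> u + variation K \<psi> v" by simp
qed (simp add: u v)

lemma variation_le_bound:
  assumes "\<And>x. x \<in> K \<Longrightarrow> 0 \<le> u x" "\<And>x. x \<in> K \<Longrightarrow> u x \<le> B" "0 \<le> B"
  shows "variation K \<psi> u \<le> C * B"
  using assms by (intro variation_least bound) (auto intro: order_trans)

text \<open>This replaces dominated convergence for a representing measure. The set \<open>U m\<close> stands for
  the lower semicontinuous function \<open>sup\<^sub>i\<^sub>\<ge>\<^sub>m u\<^sub>i\<close> and \<open>s m\<close> for its measure.\<close>

lemma variation_small: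
  assumes u: "\<And>n. continuous_on K (u n)" "\<And>n x. x \<in> K \<Longrightarrow> 0 \<le> u n x"
      "\<And>n x. x \<in> K \<Longrightarrow> u n x \<le> B" "0 \<le> B"
    and lim: "\<And>x. x \<in> K \<Longrightarrow> (\<lambda>n. u n x) \<longlonglongrightarrow> 0"
    and d: "0 < d"
  shows "\<exists>n. variation K \<psi> (u n) < d"
proof (rule ccontr)
  assume "\<not> (\<exists>n. variation K \<psi> (u n) < d)"
  then have big: "d \<le> variation K \<psi> (u n)" for n
    by (simp add: not_less)
  define U where "U m = {h. continuous_on K h \<and> (\<forall>x\<in>K. 0 \<le> h x \<and> (\<exists>i\<ge>m. h x \<le> u i x))}" for m
  define s where "s m = (SUP h\<in>U m. variation K \<psi> h)" for m
  have bdd: "bdd_above (variation K \<psi> ` U m)" for m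
  proof (rule bdd_aboveI2)
    fix h assume "h \<in> U m"
    then show "variation K \<psi> h \<le> C * B"
      using u(3,4) by (intro variation_le_bound) (fastforce simp: U_def intro: order_trans)+
  qed
  have s_up: "variation K \<psi> h \<le> s m" if "h \<in> U m" for h m
    unfolding s_def using that bdd by (rule cSUP_upper)
  have uU: "u m \<in> U m" for m
    using u by (auto simp: U_def)
  \<comment> \<open>The permitted losses \<open>d / 2 ^ (m + 2)\<close> sum to \<open>d / 2\<close>,
    so the running minima below keep a variation of at least \<open>d / 2\<close>.\<close>
  have "\<exists>h\<in>U m. s m - d / 2 ^ (m + 2) < variation K \<psi> h" for m
  proof -
    have "U m \<noteq> {}" using uU by blast
    then show ?thesis
      using less_cSUP_iff[OF _ bdd, of m "s m - d / 2 ^ (m + 2)"] d by (simp add: s_def)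
  qed
  then have "\<forall>m. \<exists>h. h \<in> U m \<and> s m - d / 2 ^ (m + 2) < variation K \<psi> h"
    by blast
  from choice[OF this] obtain G
    where G: "\<And>m. G m \<in> U m" "\<And>m. s m - d / 2 ^ (m + 2) < variation K \<psi> (G m)"
    by blast
  \<comment> \<open>Running minima turn the near-optimal functions into a decreasing sequence, as
    Dini's theorem requires; they stay in \<open>U m\<close> because
    \<open>F m \<le> G m\<close>.\<close>
  define F where "F = rec_nat (G 0) (\<lambda>m h x. min (h x) (G (Suc m) x))"
  have F0: "F 0 = G 0" and FS: "\<And>m. F (Suc m) = (\<lambda>x. min (F m x) (G (Suc m) x))"
    by (simp_all add: F_def)
  have FU: "F m \<in> U m" for m
  proof (induction m)
    case (Suc m)
    have "continuous_on K (\<lambda>x. min (F m x) (G (Suc m) x))"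
      using Suc G(1)[of "Suc m"] by (intro continuous_intros) (simp_all add: U_def)
    then show ?case
      using Suc G(1)[of "Suc m"] unfolding FS U_def by (simp add: min_le_iff_disj) blast
  qed (simp add: F0 G)
  \<comment> \<open>Minimum plus maximum equals the sum, and the maximum is still in
    \<open>U m\<close>, so its variation is at most \<open>s m\<close>. Passing to the minimum
    therefore loses only the deficit of \<open>G (Suc m)\<close>.\<close>
  have low: "s m - d / 2 + d / 2 ^ (m + 2) \<le> variation K \<psi> (F m)" for m
  proof (induction m)
    case 0
    then show ?case using G(2)[of 0] by (simp add: F0)
  next
    case (Suc m)
    have c: "continuous_on K (F m)" "continuous_on K (G (Suc m))"
      and nn: "\<And>x. x \<in> K \<Longrightarrow> 0 \<le> F m x" "\<And>x. x \<in> K \<Longrightarrow> 0 \<le> G (Suc m) x"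
      using FU[of m] G(1)[of "Suc m"] by (auto simp: U_def)
    have "(\<lambda>x. max (F m x) (G (Suc m) x)) \<in> U m"
    proof -
      have "continuous_on K (\<lambda>x. max (F m x) (G (Suc m) x))"
        using c by (intro continuous_intros)
      moreover have "\<exists>i\<ge>m. max (F m x) (G (Suc m) x) \<le> u i x" if "x \<in> K" for x
      proof (cases "F m x \<le> G (Suc m) x")
        case True
        then show ?thesis using G(1)[of "Suc m"] that by (auto simp: U_def dest: Suc_leD)
      next
        case False
        then show ?thesis using FU[of m] that by (auto simp: U_def max_def)
      qed
      ultimately show ?thesis using nn by (simp add: U_def le_max_iff_disj)
    qed
    then have "variation K \<psi> (\<lambda>x. max (F m x) (G (Suc m) x)) \<le> s m"
      by (rule s_up)
    moreover have "variation K \<psi> (F m) + variation K \<psi> (G (Suc m))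
        \<le> variation K \<psi> (\<lambda>x. F m x + G (Suc m) x)"
      using c nn by (intro variation_superadd) simp_all
    moreover have "(\<lambda>x. F m x + G (Suc m) x)
        = (\<lambda>x. min (F m x) (G (Suc m) x) + max (F m x) (G (Suc m) x))"
      by (auto simp: min_def max_def)
    moreover have "variation K \<psi> (\<lambda>x. min (F m x) (G (Suc m) x) + max (F m x) (G (Suc m) x))
        \<le> variation K \<psi> (F (Suc m)) + variation K \<psi> (\<lambda>x. max (F m x) (G (Suc m) x))"
      unfolding FS using c nn by (intro variation_subadd continuous_intros) (simp_all add: le_max_iff_disj)
    moreover have "d / 2 ^ (m + 2) - d / 2 ^ (Suc m + 2) = d / 2 ^ (Suc m + 2)"
      by (simp add: field_simps)
    ultimately show ?case
      using Suc G(2)[of "Suc m"] by (simp del: power_Suc)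
  qed
  have Flim: "(\<lambda>m. F m x) \<longlonglongrightarrow> 0" if x: "x \<in> K" for x
  proof (rule LIMSEQ_I)
    fix e :: real assume "0 < e"
    then obtain N where N: "\<And>n. n \<ge> N \<Longrightarrow> norm (u n x) < e"
      using LIMSEQ_D[OF lim[OF x]] by (metis diff_zero)
    have "norm (F n x - 0) < e" if n: "n \<ge> N" for n
    proof -
      obtain i where "i \<ge> n" "F n x \<le> u i x" "0 \<le> F n x"
        using FU[of n] x by (auto simp: U_def)
      then show ?thesis using N[of i] n by auto
    qed
    then show "\<exists>no. \<forall>n\<ge>no. norm (F n x - 0) < e" by blast
  qed
  \<comment> \<open>With this \<open>e\<close> the variation of \<open>F n\<close> is at most
    \<open>d / 4\<close>, below the lower bound \<open>d / 2\<close> that \<open>low\<close>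
    provides.\<close>
  define e where "e = d / (4 * (\<bar>C\<bar> + 1))"
  have e: "0 < e" using d by (simp add: e_def)
  have "\<exists>n. \<forall>x\<in>K. F n x < e"
  proof (rule Dini_zero[of K F e])
    show "continuous_on K (F n)" for n using FU[of n] by (simp add: U_def)
  qed (use compact Flim e in \<open>simp_all add: FS\<close>)
  then obtain n where n: "\<And>x. x \<in> K \<Longrightarrow> F n x < e"
    by blast
  have "variation K \<psi> (F n) \<le> C * e"
    using FU[of n] n e by (intro variation_le_bound) (simp_all add: U_def less_imp_le)
  also have "\<dots> \<le> (\<bar>C\<bar> + 1) * e"
    using e by (intro mult_right_mono) auto
  also have "\<dots> = d / 4" by (simp add: e_def field_simps)
  finally have "variation K \<psi> (F n) \<le> d / 4" .
  moreover have "d \<le> s n"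
    using s_up[OF uU] big order_trans by blast
  moreover have "0 \<le> d / 2 ^ (n + 2)" using d by simp
  ultimately show False using low[of n] d by linarith
qed

text \<open>\<open>variation_small\<close> yields only one small index, so it is applied along a
  subsequence on which \<open>\<psi> (g n)\<close> stays at least \<open>d\<close> in absolute
  value. The variation of the absolute value bounds \<open>\<psi>\<close> at the function and at its
  negative, a contradiction.\<close>

lemma tendsto_zero:
  assumes g: "\<And>n. continuous_on K (g n)" and B: "\<And>n x. x \<in> K \<Longrightarrow> \<bar>g n x\<bar> \<le> B"
    and lim: "\<And>x. x \<in> K \<Longrightarrow> (\<lambda>n. g n x) \<longlonglongrightarrow> 0"
  shows "(\<lambda>n. \<psi> (g n)) \<longlonglongrightarrow> 0"
proof (rule ccontr)
  assume "\<not> (\<lambda>n. \<psi> (g n)) \<longlonglongrightarrow> 0"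
  then obtain d where d: "0 < d" "\<forall>N. \<exists>n\<ge>N. d \<le> \<bar>\<psi> (g n)\<bar>"
    unfolding lim_sequentially by (auto simp: dist_real_def not_less)
  then have "infinite {n. d \<le> \<bar>\<psi> (g n)\<bar>}"
    by (auto simp: infinite_nat_iff_unbounded_le)
  from infinite_enumerate[OF this]
  obtain r :: "nat \<Rightarrow> nat" where r: "strict_mono r" "\<And>n. d \<le> \<bar>\<psi> (g (r n))\<bar>"
    by auto
  have "\<exists>n. variation K \<psi> (\<lambda>x. \<bar>g (r n) x\<bar>) < d"
  proof (rule variation_small[where B = "max 0 B"])
    show "(\<lambda>n. \<bar>g (r n) x\<bar>) \<longlonglongrightarrow> 0" if "x \<in> K" for x
      using LIMSEQ_subseq_LIMSEQ[OF lim[OF that] r(1)] by (simp add: o_def tendsto_rabs_zero)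
    show "continuous_on K (\<lambda>x. \<bar>g (r n) x\<bar>)" for n
      using g by (intro continuous_intros)
  qed (use B d in \<open>simp_all add: le_max_iff_disj\<close>)
  then obtain n where n: "variation K \<psi> (\<lambda>x. \<bar>g (r n) x\<bar>) < d" ..
  have "\<psi> (g (r n)) \<le> variation K \<psi> (\<lambda>x. \<bar>g (r n) x\<bar>)"
    using g by (intro variation_upper continuous_intros) auto
  moreover have "\<psi> (\<lambda>x. - g (r n) x) \<le> variation K \<psi> (\<lambda>x. \<bar>g (r n) x\<bar>)"
    using g by (intro variation_upper continuous_intros) auto
  ultimately show False using r(2)[of n] n neg[OF g, of "r n"] by auto
qed

end

section \<open>Bounded pointwise convergence and weak Cauchy sequences\<close>

text \<open>Both the functions and the values of the functional are split into real and imaginary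
  parts, which gives four instances of the real result.\<close>

lemma dual_functional_tendsto_zero:
  assumes K: "compact K" and \<phi>: "dual_functional K \<phi>"
    and g: "\<And>n. continuous_on K (g n)" and B: "\<And>n x. x \<in> K \<Longrightarrow> norm (g n x) \<le> B"
    and lim: "\<And>x. x \<in> K \<Longrightarrow> (\<lambda>n. g n x) \<longlonglongrightarrow> 0"
  shows "(\<lambda>n. \<phi> (g n)) \<longlonglongrightarrow> 0"
proof -
  have lin: "\<phi> (\<lambda>x. a * u x + b * v x) = a * \<phi> u + b * \<phi> v"
    if "continuous_on K u" "continuous_on K v" for u v a b
    using \<phi> that by (auto simp: dual_functional_def CK_def)
  obtain C where C: "\<And>u. continuous_on K u \<Longrightarrow> norm (\<phi> u) \<le> C * supn K u"
    using \<phi> by (auto simp: dual_functional_def CK_def)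
  have bd: "norm (\<phi> (\<lambda>x. of_real (u x))) \<le> \<bar>C\<bar> * B"
    if "continuous_on K u" "0 \<le> B" "\<And>x. x \<in> K \<Longrightarrow> \<bar>u x\<bar> \<le> B" for u :: "'a \<Rightarrow> real" and B
  proof -
    have u: "continuous_on K (\<lambda>x. complex_of_real (u x))"
      using that(1) by (intro continuous_intros)
    have "norm (\<phi> (\<lambda>x. of_real (u x))) \<le> C * supn K (\<lambda>x. of_real (u x))"
      by (rule C[OF u])
    also have "\<dots> \<le> \<bar>C\<bar> * supn K (\<lambda>x. of_real (u x))"
      using supn_nonneg[OF K u] by (intro mult_right_mono) auto
    also have "\<dots> \<le> \<bar>C\<bar> * B"
      using that by (intro mult_left_mono supn_le) auto
    finally show ?thesis .
  qed
  have add: "\<phi> (\<lambda>x. of_real (u x + v x)) = \<phi> (\<lambda>x. of_real (u x)) + \<phi> (\<lambda>x. of_real (v x))"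
    if "continuous_on K u" "continuous_on K v" for u v :: "'a \<Rightarrow> real"
    using lin[of "\<lambda>x. of_real (u x)" "\<lambda>x. of_real (v x)" 1 1] that
    by (simp add: continuous_on_of_real)
  have neg: "\<phi> (\<lambda>x. of_real (- u x)) = - \<phi> (\<lambda>x. of_real (u x))"
    if "continuous_on K u" for u :: "'a \<Rightarrow> real"
    using lin[of "\<lambda>x. of_real (u x)" "\<lambda>x. of_real (u x)" "-1" 0] that
    by (simp add: continuous_on_of_real)
  interpret R: bounded_real_functional K "\<lambda>u. Re (\<phi> (\<lambda>x. of_real (u x)))" "\<bar>C\<bar>"
    by unfold_locales
      (use K add neg in \<open>simp_all add: order_trans[OF complex_Re_le_cmod bd]\<close>)
  interpret I: bounded_real_functional K "\<lambda>u. Im (\<phi> (\<lambda>x. of_real (u x)))" "\<bar>C\<bar>"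
    by unfold_locales
      (use K add neg in \<open>simp_all add: order_trans[OF order_trans[OF abs_ge_self abs_Im_le_cmod] bd]\<close>)
  have real: "(\<lambda>n. \<phi> (\<lambda>x. of_real (u n x))) \<longlonglongrightarrow> 0"
    if "\<And>n. continuous_on K (u n)" "\<And>n x. x \<in> K \<Longrightarrow> \<bar>u n x\<bar> \<le> B"
      "\<And>x. x \<in> K \<Longrightarrow> (\<lambda>n. u n x) \<longlonglongrightarrow> 0" for u :: "nat \<Rightarrow> 'a \<Rightarrow> real"
    using tendsto_Complex[OF R.tendsto_zero[OF that] I.tendsto_zero[OF that]]
    by (simp add: zero_complex.code)
  have "(\<lambda>n. \<phi> (\<lambda>x. of_real (Re (g n x)))) \<longlonglongrightarrow> 0"
  proof (rule real)
    show "(\<lambda>n. Re (g n x)) \<longlonglongrightarrow> 0" if "x \<in> K" for x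
      using tendsto_Re[OF lim[OF that]] by simp
    show "\<bar>Re (g n x)\<bar> \<le> B" if "x \<in> K" for n x
      using order_trans[OF abs_Re_le_cmod B[OF that]] .
  qed (intro continuous_intros g)
  moreover have "(\<lambda>n. \<phi> (\<lambda>x. of_real (Im (g n x)))) \<longlonglongrightarrow> 0"
  proof (rule real)
    show "(\<lambda>n. Im (g n x)) \<longlonglongrightarrow> 0" if "x \<in> K" for x
      using tendsto_Im[OF lim[OF that]] by simp
    show "\<bar>Im (g n x)\<bar> \<le> B" if "x \<in> K" for n x
      using order_trans[OF abs_Im_le_cmod B[OF that]] .
  qed (intro continuous_intros g)
  ultimately have "(\<lambda>n. \<phi> (\<lambda>x. of_real (Re (g n x))) + \<i> * \<phi> (\<lambda>x. of_real (Im (g n x)))) \<longlonglongrightarrow> 0 + \<i> * 0"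
    by (intro tendsto_intros)
  moreover have "\<phi> (\<lambda>x. of_real (Re (g n x))) + \<i> * \<phi> (\<lambda>x. of_real (Im (g n x))) = \<phi> (g n)" for n
  proof -
    have "\<phi> (\<lambda>x. 1 * of_real (Re (g n x)) + \<i> * of_real (Im (g n x)))
        = 1 * \<phi> (\<lambda>x. of_real (Re (g n x))) + \<i> * \<phi> (\<lambda>x. of_real (Im (g n x)))"
      by (intro lin continuous_intros g)
    moreover have "(\<lambda>x. 1 * of_real (Re (g n x)) + \<i> * of_real (Im (g n x))) = g n"
      by (auto simp: complex_eq_iff)
    ultimately show ?thesis by simp
  qed
  ultimately show ?thesis by simp
qed

text \<open>The limit \<open>f\<close> may be discontinuous, so \<open>\<phi>\<close> is tested on
  differences of late terms instead. These are continuous, uniformly bounded and tend to 0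
  pointwise; a failure of the Cauchy condition supplies pairs of indices that contradict the
  convergence of \<open>\<phi>\<close> to 0 on them.\<close>

lemma weak_Cauchy_pointwise_convergent:
  assumes K: "compact K" and b: "\<And>n. continuous_on K (b n)"
    and B: "\<And>n x. x \<in> K \<Longrightarrow> norm (b n x) \<le> B"
    and lim: "\<And>x. x \<in> K \<Longrightarrow> (\<lambda>n. b n x) \<longlonglongrightarrow> f x"
  shows "weak_Cauchy K b"
  unfolding weak_Cauchy_def
proof (intro allI impI)
  fix \<phi> assume \<phi>: "dual_functional K \<phi>"
  show "convergent (\<lambda>j. \<phi> (b j))"
    unfolding Cauchy_convergent_iff[symmetric]
  proof (rule ccontr)
    assume "\<not> Cauchy (\<lambda>j. \<phi> (b j))"
    then obtain e where e: "0 < e" "\<forall>N. \<exists>p. fst p \<ge> N \<and> snd p \<ge> N \<and> e \<le> dist (\<phi> (b (fst p))) (\<phi> (b (snd p)))"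
      unfolding Cauchy_def by (auto simp: not_less)
    from choice[OF e(2)] obtain p
      where p: "\<And>N. fst (p N) \<ge> N" "\<And>N. snd (p N) \<ge> N"
        "\<And>N. e \<le> dist (\<phi> (b (fst (p N)))) (\<phi> (b (snd (p N))))"
      by blast
    have filt: "filterlim (\<lambda>N. fst (p N)) at_top sequentially" "filterlim (\<lambda>N. snd (p N)) at_top sequentially"
      using p by (auto intro!: filterlim_at_top_mono[OF filterlim_ident])
    have "(\<lambda>N. \<phi> (\<lambda>x. b (fst (p N)) x - b (snd (p N)) x)) \<longlonglongrightarrow> 0"
    proof (rule dual_functional_tendsto_zero[OF K \<phi>])
      show "norm (b (fst (p N)) x - b (snd (p N)) x) \<le> B + B" if "x \<in> K" for x N
        by (rule order_trans[OF norm_triangle_ineq4 add_mono[OF B[OF that] B[OF that]]])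
      show "(\<lambda>N. b (fst (p N)) x - b (snd (p N)) x) \<longlonglongrightarrow> 0" if "x \<in> K" for x
        using tendsto_diff[OF filterlim_compose[OF lim[OF that] filt(1)] filterlim_compose[OF lim[OF that] filt(2)]]
        by simp
    qed (intro continuous_intros b)
    moreover have "\<phi> (\<lambda>x. b (fst (p N)) x - b (snd (p N)) x) = \<phi> (b (fst (p N))) - \<phi> (b (snd (p N)))" for N
    proof -
      have "\<phi> (\<lambda>x. 1 * b (fst (p N)) x + -1 * b (snd (p N)) x) = 1 * \<phi> (b (fst (p N))) + -1 * \<phi> (b (snd (p N)))"
        using \<phi> b unfolding dual_functional_def CK_def by blast
      then show ?thesis by simp
    qed
    ultimately have "(\<lambda>N. dist (\<phi> (b (fst (p N)))) (\<phi> (b (snd (p N))))) \<longlonglongrightarrow> 0"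
      by (simp add: dist_norm tendsto_norm_zero)
    then have "\<forall>\<^sub>F N in sequentially. dist (\<phi> (b (fst (p N)))) (\<phi> (b (snd (p N)))) < e"
      using e(1) by (rule order_tendstoD)
    then show False
      using p(3) by (meson eventually_sequentially not_less order_refl)
  qed
qed

section \<open>Basic sequences\<close>

lemma psum_diff: "psum b (\<lambda>j. c j - d j) n x = psum b c n x - psum b d n x"
  by (simp add: psum_def left_diff_distrib sum_subtractf)

lemma continuous_on_psum:
  assumes "\<And>j. continuous_on K (b j)"
  shows "continuous_on K (psum b c n)"
  unfolding psum_def by (intro continuous_intros assms)

text \<open>\<open>c j * b j p\<close> is the difference of two consecutive partial sums at
  \<open>p\<close>.\<close>

lemma coefficient_bound:
  assumes "\<And>m. m \<le> Suc j \<Longrightarrow> norm (psum b c m p) \<le> B" and "\<beta> \<le> norm (b j p)"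
  shows "norm (c j) * \<beta> \<le> 2 * B"
proof -
  have "norm (c j) * \<beta> \<le> norm (c j * b j p)"
    using assms(2) by (simp add: norm_mult mult_left_mono)
  also have "c j * b j p = psum b c (Suc j) p - psum b c j p"
    by (simp add: psum_def)
  also have "norm \<dots> \<le> 2 * B"
    using norm_triangle_ineq4[of "psum b c (Suc j) p" "psum b c j p"] assms(1)[of j] assms(1)[of "Suc j"]
    by simp
  finally show ?thesis .
qed

text \<open>Grunblum's criterion, with the norm bounds written pointwise. At \<open>p\<close> all
  \<open>b j\<close> are bounded away from zero, so partial sums at \<open>p\<close> control each
  coefficient; this gives uniqueness and the convergence of the coefficients of
  approximants.\<close>

lemma Grunblum_basic_seq:
  assumes K: "compact K" and b: "\<And>j. continuous_on K (b j)"
    and p: "p \<in> K" and \<beta>: "0 < \<beta>" "\<And>j. \<beta> \<le> norm (b j p)"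
    and A: "0 \<le> A"
    and Grunblum: "\<And>c m n B x. \<lbrakk>m \<le> n; \<And>x. x \<in> K \<Longrightarrow> norm (psum b c n x) \<le> B; x \<in> K\<rbrakk>
      \<Longrightarrow> norm (psum b c m x) \<le> A * B"
  shows "basic_seq K b"
  unfolding basic_seq_def
proof (intro conjI allI ballI ex_ex1I)
  show "b j \<in> CK K" for j using b by (simp add: CK_def)
next
  fix x c d assume x: "x \<in> cspan K b" and c: "expands K b c x" and d: "expands K b d x"
  have cx: "continuous_on K x" using x by (simp add: cspan_def CK_def)
  have c0: "continuous_on K (\<lambda>t. x t - psum b c n t)" for c n
    by (intro continuous_intros cx continuous_on_psum b)
  \<comment> \<open>The long partial sums of the difference of two expansions of \<open>x\<close>
    are small; letting \<open>n\<close> grow forces each fixed partial sum at \<open>p\<close> to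
    vanish.\<close>
  have bd: "norm (psum b (\<lambda>j. c j - d j) m p)
      \<le> A * (supn K (\<lambda>t. x t - psum b c n t) + supn K (\<lambda>t. x t - psum b d n t))" if "m \<le> n" for m n
  proof (rule Grunblum[OF that _ p])
    fix t assume t: "t \<in> K"
    have "norm (psum b (\<lambda>j. c j - d j) n t) \<le> norm (x t - psum b c n t) + norm (x t - psum b d n t)"
      unfolding psum_diff by norm
    then show "norm (psum b (\<lambda>j. c j - d j) n t)
        \<le> supn K (\<lambda>t. x t - psum b c n t) + supn K (\<lambda>t. x t - psum b d n t)"
      using norm_le_supn[OF K c0[of c n] t] norm_le_supn[OF K c0[of d n] t] by linarith
  qed
  have lim: "(\<lambda>n. A * (supn K (\<lambda>t. x t - psum b c n t) + supn K (\<lambda>t. x t - psum b d n t))) \<longlonglongrightarrow> A * (0 + 0)"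
    using c d unfolding expands_def by (intro tendsto_intros)
  have zero: "norm (psum b (\<lambda>j. c j - d j) m p) \<le> 0" for m
  proof (rule tendsto_lowerbound[OF lim[simplified]])
    show "\<forall>\<^sub>F n in sequentially. norm (psum b (\<lambda>j. c j - d j) m p)
        \<le> A * (supn K (\<lambda>t. x t - psum b c n t) + supn K (\<lambda>t. x t - psum b d n t))"
      using bd by (auto simp: eventually_sequentially)
  qed simp
  show "c = d"
  proof
    fix j
    have "norm (c j - d j) * \<beta> \<le> 2 * 0"
      by (rule coefficient_bound) (use zero \<beta> in auto)
    then show "c j = d j" using \<beta>(1) by (simp add: mult_le_0_iff)
  qed
next
  fix x assume x: "x \<in> cspan K b"
  have cx: "continuous_on K x" using x by (simp add: cspan_def CK_def)
  \<comment> \<open>\<open>cN\<close> pairs coefficients with a length. Coefficients beyond the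
    length are set to zero, so all longer partial sums coincide with the approximant.\<close>
  have "\<exists>cN. \<forall>m\<ge>snd cN. \<forall>t\<in>K. norm (x t - psum b (fst cN) m t) \<le> (1/2) ^ k" for k
  proof -
    have "\<forall>e>0. \<exists>n c. supn K (\<lambda>t. x t - psum b c n t) < e"
      using x by (simp add: cspan_def)
    from this[rule_format, of "(1/2) ^ k"]
    obtain n c where nc: "supn K (\<lambda>t. x t - psum b c n t) < (1/2) ^ k"
      by auto
    have "norm (x t - psum b (\<lambda>j. if j < n then c j else 0) m t) \<le> (1/2) ^ k" if "m \<ge> n" "t \<in> K" for m t
    proof -
      have "psum b (\<lambda>j. if j < n then c j else 0) m t = (\<Sum>j\<in>{..<n}. (if j < n then c j else 0) * b j t)"
        unfolding psum_def using that(1) by (intro sum.mono_neutral_right) auto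
      then have eq: "psum b (\<lambda>j. if j < n then c j else 0) m t = psum b c n t"
        by (simp add: psum_def)
      have "continuous_on K (\<lambda>t. x t - psum b c n t)"
        by (intro continuous_intros cx continuous_on_psum b)
      from norm_le_supn[OF K this that(2)] nc show ?thesis by (simp add: eq)
    qed
    then show ?thesis by (intro exI[of _ "(\<lambda>j. if j < n then c j else 0, n)"]) simp
  qed
  then have "\<forall>k. \<exists>cN. \<forall>m\<ge>snd cN. \<forall>t\<in>K. norm (x t - psum b (fst cN) m t) \<le> (1/2) ^ k"
    by blast
  from choice[OF this] obtain cN where cN: "\<And>k m t. \<lbrakk>m \<ge> snd (cN k); t \<in> K\<rbrakk>
      \<Longrightarrow> norm (x t - psum b (fst (cN k)) m t) \<le> (1/2) ^ k"
    by blast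
  define d where "d k = fst (cN k)" for k
  \<comment> \<open>For \<open>n\<close> beyond both lengths the two partial sums are close to
    \<open>x\<close>; the criterion passes this down to every \<open>m\<close>, uniformly in
    \<open>m\<close>.\<close>
  have diff: "norm (psum b (\<lambda>j. d k j - d l j) m t) \<le> A * ((1/2) ^ k + (1/2) ^ l)" if t: "t \<in> K" for k l m t
  proof (rule Grunblum[OF _ _ t])
    define n where "n = max m (max (snd (cN k)) (snd (cN l)))"
    show "m \<le> n" by (simp add: n_def)
    fix u assume u: "u \<in> K"
    have "norm (psum b (\<lambda>j. d k j - d l j) n u) \<le> norm (x u - psum b (d k) n u) + norm (x u - psum b (d l) n u)"
      unfolding psum_diff by norm
    also have "\<dots> \<le> (1/2) ^ k + (1/2) ^ l"
      unfolding d_def using u by (intro add_mono cN) (simp_all add: n_def)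
    finally show "norm (psum b (\<lambda>j. d k j - d l j) n u) \<le> (1/2) ^ k + (1/2) ^ l" .
  qed
  have "convergent (\<lambda>k. d k j)" for j
    unfolding Cauchy_convergent_iff[symmetric]
  proof (rule metric_CauchyI)
    fix e :: real assume e: "0 < e"
    have "(\<lambda>k. 2 * (A * ((1/2) ^ k + (1/2) ^ k)) / \<beta>) \<longlonglongrightarrow> 2 * (A * (0 + 0)) / \<beta>"
      by (intro tendsto_intros) (use \<beta> in auto)
    then have "\<forall>\<^sub>F k in sequentially. 2 * (A * ((1/2) ^ k + (1/2) ^ k)) / \<beta> < e"
      using e by (intro order_tendstoD(2)) auto
    then obtain N where N: "2 * (A * ((1/2) ^ N + (1/2) ^ N)) / \<beta> < e"
      by (auto simp: eventually_sequentially)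
    have "dist (d k j) (d l j) < e" if "k \<ge> N" "l \<ge> N" for k l
    proof -
      have "norm (d k j - d l j) * \<beta> \<le> 2 * (A * ((1/2) ^ k + (1/2) ^ l))"
        by (rule coefficient_bound[where p = p]) (use diff[OF p] \<beta> in auto)
      also have "\<dots> \<le> 2 * (A * ((1/2) ^ N + (1/2) ^ N))"
        using A that by (intro mult_left_mono add_mono power_decreasing) auto
      finally have "norm (d k j - d l j) \<le> 2 * (A * ((1/2) ^ N + (1/2) ^ N)) / \<beta>"
        using \<beta>(1) by (simp add: pos_le_divide_eq)
      then show ?thesis using N by (simp add: dist_norm)
    qed
    then show "\<exists>N. \<forall>k\<ge>N. \<forall>l\<ge>N. dist (d k j) (d l j) < e" by blast
  qed
  then obtain c where c: "\<And>j. (\<lambda>k. d k j) \<longlonglongrightarrow> c j"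
    unfolding convergent_def by metis
  \<comment> \<open>Let \<open>l\<close> tend to infinity in \<open>diff\<close>; the bound is again
    uniform in \<open>m\<close>.\<close>
  have close: "norm (psum b (d k) m t - psum b c m t) \<le> A * (1/2) ^ k" if t: "t \<in> K" for k m t
  proof -
    have "(\<lambda>l. norm (psum b (\<lambda>j. d k j - d l j) m t)) \<longlonglongrightarrow> norm (psum b (\<lambda>j. d k j - c j) m t)"
      unfolding psum_def by (intro tendsto_intros c)
    moreover have "(\<lambda>l. A * ((1/2) ^ k + (1/2) ^ l)) \<longlonglongrightarrow> A * ((1/2) ^ k + 0)"
      by (intro tendsto_intros) auto
    ultimately have "norm (psum b (\<lambda>j. d k j - c j) m t) \<le> A * ((1/2) ^ k + 0)"
      by (rule LIMSEQ_le) (use diff[OF t] in blast)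
    then show ?thesis by (simp add: psum_diff)
  qed
  have "expands K b c x"
    unfolding expands_def
  proof (rule LIMSEQ_I)
    fix e :: real assume e: "0 < e"
    have "(\<lambda>k. (1/2) ^ k + A * (1/2) ^ k) \<longlonglongrightarrow> 0 + A * 0"
      by (intro tendsto_intros) auto
    then have "\<forall>\<^sub>F k in sequentially. (1/2) ^ k + A * (1/2) ^ k < e"
      using e by (intro order_tendstoD(2)) auto
    then obtain k where k: "(1/2) ^ k + A * (1/2) ^ k < e"
      by (auto simp: eventually_sequentially)
    have "norm (supn K (\<lambda>t. x t - psum b c m t) - 0) < e" if m: "m \<ge> snd (cN k)" for m
    proof -
      have "supn K (\<lambda>t. x t - psum b c m t) \<le> (1/2) ^ k + A * (1/2) ^ k"
      proof (rule supn_le)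
        fix t assume t: "t \<in> K"
        have "norm (x t - psum b c m t) \<le> norm (x t - psum b (d k) m t) + norm (psum b (d k) m t - psum b c m t)"
          by norm
        also have "\<dots> \<le> (1/2) ^ k + A * (1/2) ^ k"
          unfolding d_def using cN[OF m t] close[OF t, of k m] unfolding d_def by (intro add_mono)
        finally show "norm (x t - psum b c m t) \<le> (1/2) ^ k + A * (1/2) ^ k" .
      qed (use A in simp)
      moreover have "0 \<le> supn K (\<lambda>t. x t - psum b c m t)"
        by (intro supn_nonneg K continuous_intros cx continuous_on_psum b)
      ultimately show ?thesis using k by simp
    qed
    then show "\<exists>no. \<forall>m\<ge>no. norm (supn K (\<lambda>t. x t - psum b c m t) - 0) < e" by blast
  qed
  then show "\<exists>c. expands K b c x" by blast
qed

section \<open>Trees of jumps\<close>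

text \<open>Well-foundedness is built into the datatype: each branch is finite, though the branches
  of one tree may have unbounded lengths.\<close>

datatype 'a jump_tree = Leaf 'a | Node 'a "nat \<Rightarrow> 'a jump_tree"

primrec apex :: "'a jump_tree \<Rightarrow> 'a" where
  "apex (Leaf t) = t"
| "apex (Node t ch) = t"

text \<open>Along a branch, moves to a child alternate between free moves (flag \<open>False\<close>) and moves
  whose increment of \<open>g\<close> is counted (flag \<open>True\<close>); the counted increments add up to at least \<open>l\<close>.\<close>

primrec admissible :: "'a::metric_space set \<Rightarrow> ('a \<Rightarrow> real) \<Rightarrow> 'a jump_tree \<Rightarrow> bool \<Rightarrow> real \<Rightarrow> bool" where
  "admissible K g (Leaf t) = (\<lambda>p l. t \<in> K \<and> \<not> p \<and> l \<le> 0)"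
| "admissible K g (Node t ch) = (\<lambda>p l. t \<in> K \<and> (\<forall>n. dist (apex (ch n)) t < 1 / Suc n \<and>
     admissible K g (ch n) (\<not> p) (if p then l - (g (apex (ch n)) - g t) else l)))"

lemma admissible_apex: "admissible K g T p l \<Longrightarrow> apex T \<in> K"
  by (cases T) auto

lemma admissible_mono: "\<lbrakk>admissible K g T p l; l' \<le> l\<rbrakk> \<Longrightarrow> admissible K g T p l'"
proof (induction T arbitrary: p l l')
  case (Node t ch)
  have "admissible K g (ch n) (\<not> p) (l' - x)" if "admissible K g (ch n) (\<not> p) (l - x)" for n x
    by (rule Node.IH[OF rangeI that]) (use Node.prems(2) in simp)
  from this[of _ 0] this show ?case using Node.prems(1) by (cases p) simp_all
qed simp

section \<open>Semicontinuity and trees with large increments\<close>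

text \<open>Upper semicontinuity is phrased through points within \<open>1 / Suc n\<close>, the
  distance that \<open>admissible\<close> asks of the \<open>n\<close>-th child.\<close>

lemma usc_imp_lsc_uminus:
  assumes usc: "\<And>t c. \<lbrakk>t \<in> K; \<And>n. \<exists>s\<in>K. dist s t < 1 / Suc n \<and> c < w s\<rbrakk> \<Longrightarrow> c \<le> w t"
  shows "lsc_on K (\<lambda>x. - w x)"
  unfolding lsc_on_def openin_contains_ball
proof (intro allI conjI ballI)
  fix a x assume x: "x \<in> {x \<in> K. a < - w x}"
  show "\<exists>e>0. ball x e \<inter> K \<subseteq> {x \<in> K. a < - w x}"
  proof (rule ccontr)
    assume none: "\<not> (\<exists>e>0. ball x e \<inter> K \<subseteq> {x \<in> K. a < - w x})"
    \<comment> \<open>\<open>(w x - a) / 2\<close> is the midpoint of \<open>w x\<close> and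
      \<open>- a\<close>, hence strictly between them.\<close>
    have "\<exists>s\<in>K. dist s x < 1 / Suc n \<and> (w x - a) / 2 < w s" for n
    proof -
      have "\<not> ball x (1 / Suc n) \<inter> K \<subseteq> {x \<in> K. a < - w x}"
        using none by simp
      then obtain s where "s \<in> ball x (1 / Suc n)" "s \<in> K" "\<not> a < - w s"
        by blast
      then show ?thesis using x by (intro bexI[of _ s]) (simp_all add: dist_commute)
    qed
    from usc[OF _ this] x show False by auto
  qed
qed auto

text \<open>\<open>v t\<close> is the supremum of the increments over trees with root
  \<open>t\<close>. Grafting trees near \<open>t\<close> onto a new root shows that \<open>v\<close>
  and \<open>v + g\<close> are upper semicontinuous, and \<open>g\<close> is the difference of
  \<open>- v\<close> and \<open>- (v + g)\<close>.\<close>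

lemma bounded_trees_imp_lsc_diff:
  assumes bd: "\<And>T l. admissible K g T False l \<Longrightarrow> l \<le> L"
    and M: "\<And>x. x \<in> K \<Longrightarrow> \<bar>g x\<bar> \<le> M"
  shows "\<exists>u v. bounded_on K u \<and> bounded_on K v \<and> lsc_on K u \<and> lsc_on K v \<and> (\<forall>x\<in>K. g x = u x - v x)"
proof -
  define S where "S t = {l. \<exists>T. apex T = t \<and> admissible K g T False l}" for t
  define v where "v t = Sup (S t)" for t
  have S0: "0 \<in> S t" if "t \<in> K" for t
    using that by (auto simp: S_def intro!: exI[of _ "Leaf t"])
  have bdd: "bdd_above (S t)" for t
    using bd by (auto simp: S_def intro!: bdd_aboveI[of _ L])
  have up: "c \<le> v (apex T)" if "admissible K g T False c" for T c
    unfolding v_def by (rule cSup_upper[OF _ bdd]) (use that in \<open>auto simp: S_def\<close>)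
  have low: "\<exists>T. apex T = t \<and> admissible K g T False c" if t: "t \<in> K" "c < v t" for t c
  proof -
    have "S t \<noteq> {}" using S0[OF t(1)] by blast
    from less_cSup_iff[OF this bdd] t(2) obtain l where "l \<in> S t" "c < l"
      unfolding v_def by blast
    then show ?thesis using admissible_mono[of K g _ False l c] by (auto simp: S_def)
  qed
  have vbd: "\<bar>v t\<bar> \<le> L" if "t \<in> K" for t
  proof -
    have "0 \<le> v t" unfolding v_def by (rule cSup_upper[OF S0[OF that] bdd])
    moreover have "v t \<le> L"
      unfolding v_def using S0[OF that] bd by (intro cSup_least) (auto simp: S_def)
    ultimately show ?thesis by simp
  qed
  have "lsc_on K (\<lambda>x. - v x)"
  proof (rule usc_imp_lsc_uminus)
    fix t c assume t: "t \<in> K" and near: "\<And>n. \<exists>s\<in>K. dist s t < 1 / Suc n \<and> c < v s"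
    have "\<forall>n. \<exists>T. dist (apex T) t < 1 / Suc n \<and> admissible K g T False c"
      using near low by metis
    from choice[OF this] obtain T
      where T: "\<And>n. dist (apex (T n)) t < 1 / Suc n" "\<And>n. admissible K g (T n) False c"
      by blast
    \<comment> \<open>The free move goes to the root of \<open>T n\<close>; the constant inner node
      then spends the counted move with zero increment.\<close>
    have "admissible K g (Node t (\<lambda>n. Node (apex (T n)) (\<lambda>_. T n))) False c"
      using t T admissible_apex[OF T(2)] by simp
    from up[OF this] show "c \<le> v t" by simp
  qed
  moreover have "lsc_on K (\<lambda>x. - (v x + g x))"
  proof (rule usc_imp_lsc_uminus)
    fix t c assume t: "t \<in> K" and near: "\<And>n. \<exists>s\<in>K. dist s t < 1 / Suc n \<and> c < v s + g s"
    have "\<exists>T. dist (apex T) t < 1 / Suc n \<and> admissible K g T False (c - g (apex T))" for n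
    proof -
      obtain s where s: "s \<in> K" "dist s t < 1 / Suc n" "c - g s < v s"
        using near[of n] by (auto simp: less_diff_eq diff_less_eq)
      from low[OF s(1,3)] s(2) show ?thesis by auto
    qed
    then have "\<forall>n. \<exists>T. dist (apex T) t < 1 / Suc n \<and> admissible K g T False (c - g (apex T))"
      by blast
    from choice[OF this] obtain T
      where T: "\<And>n. dist (apex (T n)) t < 1 / Suc n" "\<And>n. admissible K g (T n) False (c - g (apex (T n)))"
      by blast
    \<comment> \<open>The free move stays at \<open>t\<close>, and the counted move to the root of
      \<open>T n\<close> earns \<open>g (apex (T n)) - g t\<close>.\<close>
    have "admissible K g (Node t (\<lambda>_. Node t T)) False (c - g t)"
      using t T by simp
    from up[OF this] show "c \<le> v t + g t" by simp
  qed
  moreover have "bounded_on K (\<lambda>x. - v x)"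
    unfolding bounded_on_def using vbd by auto
  moreover have "bounded_on K (\<lambda>x. - (v x + g x))"
    unfolding bounded_on_def
  proof (intro exI ballI)
    fix x assume "x \<in> K"
    then show "\<bar>- (v x + g x)\<bar> \<le> L + M" using vbd[of x] M[of x] by linarith
  qed
  moreover have "\<forall>x\<in>K. g x = - v x - - (v x + g x)" by simp
  ultimately show ?thesis by blast
qed

lemma continuous_imp_lsc:
  assumes "continuous_on K u"
  shows "lsc_on K u"
  unfolding lsc_on_def
proof
  fix a
  have "{x \<in> K. a < u x} = K \<inter> u -` {a<..}" by auto
  then show "openin (top_of_set K) {x \<in> K. a < u x}"
    using continuous_openin_preimage_gen[OF assms, of "{a<..}"] by simp
qed

text \<open>A bounded continuous function lies in D(K) with zero as both subtracted functions. The
  discontinuity later supplies a jump of fixed size and a point where \<open>f\<close> is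
  nonzero.\<close>

lemma not_inD_imp_not_continuous:
  assumes M: "\<And>x. x \<in> K \<Longrightarrow> norm (f x) \<le> M" and f: "\<not> inD K f"
  shows "\<not> continuous_on K f"
proof
  assume c: "continuous_on K f"
  have "bounded_on K (\<lambda>x. Re (f x))" "bounded_on K (\<lambda>x. Im (f x))" "bounded_on K (\<lambda>x. 0)"
    unfolding bounded_on_def
    using order_trans[OF abs_Re_le_cmod M] order_trans[OF abs_Im_le_cmod M] by auto
  moreover have "lsc_on K (\<lambda>x. Re (f x))" "lsc_on K (\<lambda>x. Im (f x))" "lsc_on K (\<lambda>x. 0)"
    by (intro continuous_imp_lsc continuous_intros c)+
  moreover have "\<forall>x\<in>K. f x = Complex (Re (f x) - 0) (Im (f x) - 0)" by simp
  ultimately show False using f unfolding inD_def by blast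
qed

text \<open>For \<open>w = 1\<close> and \<open>w = - \<i>\<close> the real part of
  \<open>w * f\<close> is the real and the imaginary part of \<open>f\<close>; if the increments
  were bounded for both, \<open>f\<close> would be in D(K). Keeping \<open>w\<close> general lets
  the sequel treat both cases at once.\<close>

lemma not_inD_imp_unbounded_trees:
  assumes M: "\<And>x. x \<in> K \<Longrightarrow> norm (f x) \<le> M" and f: "\<not> inD K f"
  shows "\<exists>w. norm w = 1 \<and> (\<forall>L. \<exists>T. admissible K (\<lambda>x. Re (w * f x)) T False L)"
proof (rule ccontr)
  assume *: "\<not> ?thesis"
  have diff: "\<exists>u v. bounded_on K u \<and> bounded_on K v \<and> lsc_on K u \<and> lsc_on K v \<and> (\<forall>x\<in>K. Re (w * f x) = u x - v x)"
    if w: "norm w = 1" for w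
  proof -
    obtain L where L: "\<nexists>T. admissible K (\<lambda>x. Re (w * f x)) T False L"
      using * w by blast
    show ?thesis
    proof (rule bounded_trees_imp_lsc_diff)
      show "l \<le> L" if "admissible K (\<lambda>x. Re (w * f x)) T False l" for T l
        using L admissible_mono[OF that, of L] by force
      show "\<bar>Re (w * f x)\<bar> \<le> M" if "x \<in> K" for x
        using abs_Re_le_cmod[of "w * f x"] M[OF that] w by (simp add: norm_mult)
    qed
  qed
  obtain u1 u2 where u: "bounded_on K u1" "bounded_on K u2" "lsc_on K u1" "lsc_on K u2"
      "\<forall>x\<in>K. Re (1 * f x) = u1 x - u2 x"
    using diff[of 1] by auto
  obtain u3 u4 where v: "bounded_on K u3" "bounded_on K u4" "lsc_on K u3" "lsc_on K u4"
      "\<forall>x\<in>K. Re (- \<i> * f x) = u3 x - u4 x"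
    using diff[of "- \<i>"] by auto
  have "\<forall>x\<in>K. f x = Complex (u1 x - u2 x) (u3 x - u4 x)"
    using u(5) v(5) by (simp add: complex_eq_iff)
  then show False using f u v unfolding inD_def by blast
qed

lemma uniform_modulus:
  fixes fs :: "nat \<Rightarrow> 'a::metric_space \<Rightarrow> 'b::metric_space"
  assumes K: "compact K" and cont: "\<And>k. continuous_on K (fs k)" and e: "0 < e"
  shows "\<exists>d>0. \<forall>k\<le>N. \<forall>x\<in>K. \<forall>y\<in>K. dist x y < d \<longrightarrow> dist (fs k x) (fs k y) < e"
proof (induction N)
  case 0
  show ?case
    using compact_uniformly_continuous[OF cont[of 0] K] e
    unfolding uniformly_continuous_on_def by (metis dist_commute le_zero_eq)
next
  case (Suc N)
  then obtain d where d: "d > 0" "\<forall>k\<le>N. \<forall>x\<in>K. \<forall>y\<in>K. dist x y < d \<longrightarrow> dist (fs k x) (fs k y) < e"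
    by blast
  obtain d' where d': "d' > 0" "\<forall>x\<in>K. \<forall>y\<in>K. dist y x < d' \<longrightarrow> dist (fs (Suc N) y) (fs (Suc N) x) < e"
    using compact_uniformly_continuous[OF cont[of "Suc N"] K] e
    unfolding uniformly_continuous_on_def by blast
  show ?case
    using d d' by (intro exI[of _ "min d d'"]) (auto simp: le_Suc_eq)
qed

section \<open>The subsequence\<close>

text \<open>Dependent choice over stages. Each stage involves finitely many functions and finitely
  many trees, so a common modulus of continuity, a finite net and pointwise convergence on a finite
  set suffice.\<close>

lemma selection:
  fixes K :: "'a::metric_space set" and fs :: "nat \<Rightarrow> 'a \<Rightarrow> complex"
  assumes K: "compact K" and cont: "\<And>k. continuous_on K (fs k)"
    and lim: "\<And>x. x \<in> K \<Longrightarrow> (\<lambda>k. fs k x) \<longlonglongrightarrow> f x"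
    and \<eta>: "0 < \<eta>"
    and Tr: "\<And>m. \<exists>p l. admissible K g (Tr m) p l"
    and t: "t \<in> K" and jump: "\<And>d. 0 < d \<Longrightarrow> \<exists>s\<in>K. dist s t < d \<and> \<delta> \<le> dist (f s) (f t)"
  obtains r F where "strict_mono r" "N0 \<le> r 0" "\<And>m. F m \<subseteq> F (Suc m)" "\<And>m. Tr m \<in> F m"
    "\<And>m T. T \<in> F m \<Longrightarrow> \<exists>p l. admissible K g T p l"
    "\<And>m T j. \<lbrakk>T \<in> F m; m \<le> j\<rbrakk> \<Longrightarrow> dist (fs (r j) (apex T)) (f (apex T)) < \<eta> / 4 ^ j"
    "\<And>m x. x \<in> K \<Longrightarrow> \<exists>T\<in>F (Suc m). \<forall>j\<le>m. dist (fs (r j) x) (fs (r j) (apex T)) < \<eta> / 4 ^ Suc m"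
    "\<And>m. \<exists>T\<in>F (Suc m). \<exists>S\<in>F (Suc m). \<delta> \<le> dist (f (apex T)) (f (apex S))
      \<and> (\<forall>j\<le>m. dist (fs (r j) (apex T)) (fs (r j) (apex S)) < \<eta> / 4 ^ Suc m)"
    "\<And>m u ch. Node u ch \<in> F m \<Longrightarrow> \<exists>n. ch n \<in> F (Suc m)
      \<and> (\<forall>j\<le>m. dist (fs (r j) (apex (ch n))) (fs (r j) u) < \<eta> / 4 ^ Suc m)"
proof -
  \<comment> \<open>A state consists of the finite set of active trees and an index from which on
    all terms are close to \<open>f\<close> at their roots.\<close>
  define P where "P m x \<longleftrightarrow> finite (fst x) \<and> N0 \<le> snd x \<and> Tr m \<in> fst x
      \<and> (\<forall>T\<in>fst x. \<exists>p l. admissible K g T p l)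
      \<and> (\<forall>T\<in>fst x. \<forall>k\<ge>snd x. dist (fs k (apex T)) (f (apex T)) < \<eta> / 4 ^ m)"
    for m and x :: "'a jump_tree set \<times> nat"
  \<comment> \<open>The closeness conditions range over all \<open>k\<close> up to the index
    \<open>snd x\<close>, which covers every term chosen so far.\<close>
  define Q where "Q m x y \<longleftrightarrow> snd x < snd y \<and> fst x \<subseteq> fst y
      \<and> (\<forall>z\<in>K. \<exists>T\<in>fst y. \<forall>k\<le>snd x. dist (fs k z) (fs k (apex T)) < \<eta> / 4 ^ Suc m)
      \<and> (\<exists>T\<in>fst y. \<exists>S\<in>fst y. \<delta> \<le> dist (f (apex T)) (f (apex S))
          \<and> (\<forall>k\<le>snd x. dist (fs k (apex T)) (fs k (apex S)) < \<eta> / 4 ^ Suc m))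
      \<and> (\<forall>u ch. Node u ch \<in> fst x \<longrightarrow> (\<exists>n. ch n \<in> fst y
          \<and> (\<forall>k\<le>snd x. dist (fs k (apex (ch n))) (fs k u) < \<eta> / 4 ^ Suc m)))"
    for m and x y :: "'a jump_tree set \<times> nat"
  have index: "\<exists>N>N1. \<forall>k\<ge>N. \<forall>T\<in>F. dist (fs k (apex T)) (f (apex T)) < e"
    if F: "finite F" "\<forall>T\<in>F. \<exists>p l. admissible K g T p l" and e: "0 < e" for F e and N1 :: nat
  proof -
    have "\<forall>T\<in>F. \<forall>\<^sub>F k in sequentially. dist (fs k (apex T)) (f (apex T)) < e"
    proof
      fix T assume "T \<in> F"
      then have "apex T \<in> K" using F(2) admissible_apex by blast
      from tendstoD[OF lim[OF this] e] show "\<forall>\<^sub>F k in sequentially. dist (fs k (apex T)) (f (apex T)) < e" .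
    qed
    from eventually_ball_finite[OF F(1) this] obtain N
      where N: "\<forall>k\<ge>N. \<forall>T\<in>F. dist (fs k (apex T)) (f (apex T)) < e"
      by (auto simp: eventually_sequentially)
    show ?thesis by (rule exI[of _ "max N (Suc N1)"]) (use N in simp)
  qed
  have "\<exists>x. P 0 x"
  proof -
    obtain N where "N > N0" "\<forall>k\<ge>N. \<forall>T\<in>{Tr 0}. dist (fs k (apex T)) (f (apex T)) < \<eta>"
      using index[of "{Tr 0}" \<eta> N0] Tr \<eta> by auto
    then show ?thesis
      using Tr[of 0] by (intro exI[of _ "({Tr 0}, N)"]) (simp add: P_def)
  qed
  moreover have "\<exists>y. P (Suc m) y \<and> Q m x y" if P: "P m x" for m x
  proof -
    define e where "e = \<eta> / 4 ^ Suc m"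
    have e: "0 < e" using \<eta> by (simp add: e_def)
    \<comment> \<open>One \<open>d\<close> serves all terms up to the current index; the net, the
      jump pair and the children are chosen at this scale.\<close>
    from uniform_modulus[of K fs e "snd x", OF K cont e] obtain d where "0 < d" and
      d': "\<forall>k\<le>snd x. \<forall>u\<in>K. \<forall>v\<in>K. dist u v < d \<longrightarrow> dist (fs k u) (fs k v) < e"
      by (elim exE conjE) (rule that)
    note d = \<open>0 < d\<close> d'[rule_format]
    obtain G where G: "finite G" "G \<subseteq> K" "K \<subseteq> (\<Union>u\<in>G. ball u d)"
      using seq_compact_imp_totally_bounded[OF compact_imp_seq_compact[OF K], rule_format, OF d(1)]
      by (elim exE conjE) (rule that)
    obtain s where s: "s \<in> K" "dist s t < d" "\<delta> \<le> dist (f s) (f t)"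
      using jump[OF d(1)] by (elim bexE conjE) (rule that)
    obtain n where n: "1 / real (Suc n) < d"
      using nat_approx_posE[OF d(1)] .
    \<comment> \<open>The same \<open>n\<close> serves all nodes, since the \<open>n\<close>-th
      child lies within \<open>1 / Suc n\<close> of its parent. A leaf is kept unchanged.\<close>
    define child where "child T = (case T of Leaf u \<Rightarrow> T | Node u ch \<Rightarrow> ch n)" for T :: "'a jump_tree"
    have child: "\<exists>p l. admissible K g (child T) p l" if "\<exists>p l. admissible K g T p l" for T
      using that unfolding child_def by (cases T) auto
    \<comment> \<open>Net points and the jump pair enter as leaves, since only their labels matter.
      Old trees stay active, so a child can be activated at any later stage.\<close>
    define F where "F = insert (Tr (Suc m)) (fst x \<union> child ` fst x \<union> Leaf ` (G \<union> {s, t}))"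
    have leaf: "\<exists>p l. admissible K g (Leaf u) p l" if "u \<in> K" for u
      using that by (intro exI[of _ False] exI[of _ 0]) simp
    have F: "finite F" "\<forall>T\<in>F. \<exists>p l. admissible K g T p l"
      using P G(1,2) s(1) t Tr[of "Suc m"] child leaf unfolding F_def P_def by auto
    obtain N where N: "N > snd x" "\<forall>k\<ge>N. \<forall>T\<in>F. dist (fs k (apex T)) (f (apex T)) < e"
      using index[OF F e] by blast
    have "P (Suc m) (F, N)"
      using F N P by (simp add: P_def F_def e_def)
    moreover have "Q m x (F, N)"
      unfolding Q_def fst_conv snd_conv e_def[symmetric]
    proof (intro conjI ballI allI impI)
      fix z assume z: "z \<in> K"
      then obtain u where u: "u \<in> G" "dist z u < d"
        using G(3) by (auto simp: dist_commute)
      have "\<forall>k\<le>snd x. dist (fs k z) (fs k (apex (Leaf u))) < e"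
        using d(2) z u G(2) by auto
      moreover have "Leaf u \<in> F" using u(1) by (simp add: F_def)
      ultimately show "\<exists>T\<in>F. \<forall>k\<le>snd x. dist (fs k z) (fs k (apex T)) < e" by blast
    next
      have "Leaf s \<in> F" "Leaf t \<in> F" by (simp_all add: F_def)
      moreover have "\<forall>k\<le>snd x. dist (fs k (apex (Leaf s))) (fs k (apex (Leaf t))) < e"
        using d(2) s t by simp
      moreover have "\<delta> \<le> dist (f (apex (Leaf s))) (f (apex (Leaf t)))"
        using s(3) by simp
      ultimately show "\<exists>T\<in>F. \<exists>S\<in>F. \<delta> \<le> dist (f (apex T)) (f (apex S))
          \<and> (\<forall>k\<le>snd x. dist (fs k (apex T)) (fs k (apex S)) < e)"
        by blast
    next
      fix u ch assume T: "Node u ch \<in> fst x"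
      then obtain p l where adm: "admissible K g (Node u ch) p l"
        using P unfolding P_def by blast
      have "child (Node u ch) \<in> F" unfolding F_def using T by blast
      then have "ch n \<in> F" by (simp add: child_def)
      moreover have "dist (fs k (apex (ch n))) (fs k u) < e" if "k \<le> snd x" for k
      proof (rule d(2)[OF that])
        have "dist (apex (ch n)) u < 1 / Suc n" using adm unfolding admissible.simps by blast
        then show "dist (apex (ch n)) u < d" using n by linarith
        show "apex (ch n) \<in> K" "u \<in> K"
          using adm admissible_apex[of K g "ch n"] unfolding admissible.simps by blast+
      qed
      ultimately show "\<exists>n. ch n \<in> F \<and> (\<forall>k\<le>snd x. dist (fs k (apex (ch n))) (fs k u) < e)"
        by blast
    qed (use N in \<open>auto simp: F_def\<close>)
    ultimately show ?thesis by blast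
  qed
  ultimately obtain X where "\<forall>m. P m (X m) \<and> Q m (X m) (X (Suc m))"
    using dependent_nat_choice[of P Q] by blast
  then have PX: "\<And>m. P m (X m)" and QX: "\<And>m. Q m (X m) (X (Suc m))"
    by blast+
  define r where "r m = snd (X m)" for m
  define F where "F m = fst (X m)" for m
  have r: "strict_mono r"
    using QX by (simp add: strict_mono_Suc_iff r_def Q_def)
  have r_le: "r j \<le> r m" if "j \<le> m" for j m
    using r that by (simp add: strict_mono_less_eq)
  have mono: "F m \<subseteq> F j" if "m \<le> j" for m j
    using lift_Suc_mono_le[of F, OF _ that] QX by (simp add: Q_def F_def)
  show thesis
  proof (rule that[of r F])
    show "dist (fs (r j) (apex T)) (f (apex T)) < \<eta> / 4 ^ j" if "T \<in> F m" "j \<ge> m" for m T j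
      using PX[of j] mono[OF that(2)] that(1) by (auto simp: P_def F_def r_def)
    show "\<exists>T\<in>F (Suc m). \<forall>j\<le>m. dist (fs (r j) x) (fs (r j) (apex T)) < \<eta> / 4 ^ Suc m" if "x \<in> K" for m x
    proof -
      have "\<exists>T\<in>F (Suc m). \<forall>k\<le>r m. dist (fs k x) (fs k (apex T)) < \<eta> / 4 ^ Suc m"
        using QX[of m] that unfolding Q_def F_def r_def by blast
      then show ?thesis using r_le by blast
    qed
    show "\<exists>T\<in>F (Suc m). \<exists>S\<in>F (Suc m). \<delta> \<le> dist (f (apex T)) (f (apex S))
          \<and> (\<forall>j\<le>m. dist (fs (r j) (apex T)) (fs (r j) (apex S)) < \<eta> / 4 ^ Suc m)" for m
    proof -
      have "\<exists>T\<in>F (Suc m). \<exists>S\<in>F (Suc m). \<delta> \<le> dist (f (apex T)) (f (apex S))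
          \<and> (\<forall>k\<le>r m. dist (fs k (apex T)) (fs k (apex S)) < \<eta> / 4 ^ Suc m)"
        using QX[of m] unfolding Q_def F_def r_def by blast
      then show ?thesis using r_le by blast
    qed
    show "\<exists>n. ch n \<in> F (Suc m) \<and> (\<forall>j\<le>m. dist (fs (r j) (apex (ch n))) (fs (r j) u) < \<eta> / 4 ^ Suc m)"
      if "Node u ch \<in> F m" for m u ch
    proof -
      have "\<exists>n. ch n \<in> F (Suc m) \<and> (\<forall>k\<le>r m. dist (fs k (apex (ch n))) (fs k u) < \<eta> / 4 ^ Suc m)"
        using QX[of m] that unfolding Q_def F_def r_def by blast
      then show ?thesis using r_le by blast
    qed
    show "N0 \<le> r 0" "Tr m \<in> F m" for m
      using PX[of 0] PX[of m] by (simp_all add: P_def F_def r_def)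
    show "F m \<subseteq> F (Suc m)" for m by (rule mono) simp
    show "\<exists>p l. admissible K g T p l" if "T \<in> F m" for m T
      using PX[of m] that by (simp add: P_def F_def)
  qed (rule r)
qed

section \<open>Strong summability\<close>

text \<open>A bounded divergent sequence has two distinct cluster points \<open>s\<close> and
  \<open>s'\<close>; \<open>D\<close> is \<open>s' - s\<close>, and \<open>q\<close> visits them
  alternately. \<open>D\<close> does not depend on \<open>N\<close>, so the starting time can be
  chosen once \<open>D\<close> is known.\<close>

lemma alternating_subsequence:
  fixes \<sigma> :: "nat \<Rightarrow> complex"
  assumes bd: "bounded (range \<sigma>)" and nc: "\<not> convergent \<sigma>"
  shows "\<exists>D. D \<noteq> 0 \<and> (\<forall>N. \<exists>q. strict_mono q \<and> N \<le> q 0 \<and>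
    (\<forall>i. norm (\<sigma> (q (Suc i)) - \<sigma> (q i) - (if odd i then - D else D)) \<le> 1 / 2 ^ i))"
proof -
  obtain s r where r: "strict_mono r" and s: "(\<sigma> \<circ> r) \<longlonglongrightarrow> s"
    using bounded_imp_convergent_subsequence[OF bd] by blast
  have "\<not> \<sigma> \<longlonglongrightarrow> s" using nc by (auto simp: convergent_def)
  then obtain e where e: "0 < e" "\<forall>N. \<exists>n\<ge>N. e \<le> dist (\<sigma> n) s"
    unfolding lim_sequentially by (auto simp: not_less)
  then have "infinite {n. e \<le> dist (\<sigma> n) s}"
    by (auto simp: infinite_nat_iff_unbounded_le)
  from infinite_enumerate[OF this] obtain u :: "nat \<Rightarrow> nat"
    where u: "strict_mono u" "\<And>n. e \<le> dist (\<sigma> (u n)) s"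
    unfolding mem_Collect_eq by blast
  have "bounded (range (\<sigma> \<circ> u))" by (rule bounded_subset[OF bd]) auto
  from bounded_imp_convergent_subsequence[OF this]
  obtain s' v where v: "strict_mono v" and s': "(\<sigma> \<circ> u \<circ> v) \<longlonglongrightarrow> s'"
    by blast
  \<comment> \<open>The terms along \<open>u\<close> keep distance at least \<open>e\<close> from
    \<open>s\<close>, so their cluster point does too.\<close>
  have "e \<le> dist s' s"
  proof (rule tendsto_lowerbound)
    show "(\<lambda>n. dist ((\<sigma> \<circ> u \<circ> v) n) s) \<longlonglongrightarrow> dist s' s" by (intro tendsto_intros s')
  qed (use u(2) in auto)
  then have ne: "s' - s \<noteq> 0" using e(1) by auto
  define a where "a i = (if odd i then s' else s)" for i :: nat
  have near: "\<exists>n\<ge>N. norm (\<sigma> n - a i) \<le> d" if d: "0 < d" for N i d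
  proof -
    have "\<exists>h. strict_mono h \<and> (\<sigma> \<circ> h) \<longlonglongrightarrow> a i"
    proof (cases "odd i")
      case True
      have "strict_mono (u \<circ> v)" using u(1) v by (rule strict_mono_o)
      then show ?thesis using s' True by (auto simp: a_def o_assoc)
    next
      case False
      then show ?thesis using r s by (auto simp: a_def)
    qed
    then obtain h where h: "strict_mono h" "(\<sigma> \<circ> h) \<longlonglongrightarrow> a i" by blast
    from LIMSEQ_D[OF h(2) d] obtain n0 where n0: "\<And>n. n \<ge> n0 \<Longrightarrow> norm (\<sigma> (h n) - a i) < d"
      by auto
    show ?thesis
      using n0[of "max n0 N"] seq_suble[OF h(1), of "max n0 N"]
      by (intro exI[of _ "h (max n0 N)"]) auto
  qed
  have "\<exists>q. strict_mono q \<and> N \<le> q 0 \<and>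
      (\<forall>i. norm (\<sigma> (q (Suc i)) - \<sigma> (q i) - (if odd i then - (s' - s) else s' - s)) \<le> 1 / 2 ^ i)" for N
  proof -
    \<comment> \<open>Tolerance \<open>1 / 2 ^ Suc i\<close> at visit \<open>i\<close> leaves at
      most \<open>1 / 2 ^ i\<close> for the increment to the next visit.\<close>
    have "\<exists>q. \<forall>i. (N \<le> q i \<and> norm (\<sigma> (q i) - a i) \<le> 1 / 2 ^ Suc i) \<and> q i < q (Suc i)"
    proof (rule dependent_nat_choice)
      show "\<exists>n. N \<le> n \<and> norm (\<sigma> n - a 0) \<le> 1 / 2 ^ Suc 0"
        by (rule near) simp
      show "\<exists>n'. (N \<le> n' \<and> norm (\<sigma> n' - a (Suc i)) \<le> 1 / 2 ^ Suc (Suc i)) \<and> n < n'"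
        if "N \<le> n \<and> norm (\<sigma> n - a i) \<le> 1 / 2 ^ Suc i" for n i
      proof -
        obtain n' where "n' \<ge> Suc n" "norm (\<sigma> n' - a (Suc i)) \<le> 1 / 2 ^ Suc (Suc i)"
          using near[of "1 / 2 ^ Suc (Suc i)" "Suc n" "Suc i"] by auto
        then show ?thesis using that by (intro exI[of _ n']) simp
      qed
    qed
    then obtain q where q: "\<And>i. N \<le> q i" "\<And>i. norm (\<sigma> (q i) - a i) \<le> 1 / 2 ^ Suc i"
        "\<And>i. q i < q (Suc i)"
      by blast
    have "norm (\<sigma> (q (Suc i)) - \<sigma> (q i) - (if odd i then - (s' - s) else s' - s)) \<le> 1 / 2 ^ i" for i
    proof -
      have "\<sigma> (q (Suc i)) - \<sigma> (q i) - (if odd i then - (s' - s) else s' - s)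
          = (\<sigma> (q (Suc i)) - a (Suc i)) - (\<sigma> (q i) - a i)"
        by (simp add: a_def)
      also have "norm \<dots> \<le> 1 / 2 ^ Suc (Suc i) + 1 / 2 ^ Suc i"
        by (rule order_trans[OF norm_triangle_ineq4 add_mono[OF q(2) q(2)]])
      also have "\<dots> \<le> 1 / 2 ^ i" by (simp add: field_simps)
      finally show ?thesis .
    qed
    then show ?thesis using q by (intro exI[of _ q]) (simp add: strict_mono_Suc_iff)
  qed
  then show ?thesis using ne by blast
qed

lemma sum_inverse_power4_le:
  fixes \<eta> :: real
  assumes "0 \<le> \<eta>"
  shows "(\<Sum>j=m..<n. \<eta> / 4 ^ j) \<le> 2 * \<eta>"
proof -
  have "(\<Sum>j<n. \<eta> / 4 ^ j) \<le> 2 * \<eta> - 2 * \<eta> / 4 ^ n"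
  proof (induction n)
    case (Suc n)
    have "2 * \<eta> / 4 ^ Suc n \<le> \<eta> / 4 ^ n" using assms by (simp add: field_simps)
    then show ?case using Suc by simp
  qed simp
  moreover have "(\<Sum>j=m..<n. \<eta> / 4 ^ j) \<le> (\<Sum>j<n. \<eta> / 4 ^ j)"
    using assms by (intro sum_mono2) auto
  moreover have "0 \<le> 2 * \<eta> / 4 ^ n" using assms by simp
  ultimately show ?thesis by linarith
qed

section \<open>Estimates for partial sums of the selected sequence\<close>

lemma psum_split:
  assumes "m \<le> n"
  shows "psum b c n x = psum b c m x + (\<Sum>j=m..<n. c j * b j x)"
  unfolding psum_def lessThan_atLeast0 using assms by (simp add: sum.atLeastLessThan_concat)

text \<open>The output of the selection together with its constants: \<open>p\<close> and
  \<open>\<beta>\<close> control single coefficients, the jump \<open>\<delta>\<close> controls tail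
  sums of coefficients, and \<open>small\<close> keeps the accumulated errors below half of the
  largest partial sum.\<close>

locale selected_sequence =
  fixes K :: "'a::metric_space set" and f :: "'a \<Rightarrow> complex" and b :: "nat \<Rightarrow> 'a \<Rightarrow> complex"
    and F :: "nat \<Rightarrow> 'a jump_tree set" and Tr :: "nat \<Rightarrow> 'a jump_tree"
    and M \<delta> \<eta> \<beta> :: real and p :: 'a and w :: complex
  assumes compact: "compact K" and cont: "\<And>j. continuous_on K (b j)"
    and M: "\<And>x. x \<in> K \<Longrightarrow> norm (f x) \<le> M"
    and F_Suc: "\<And>m. F m \<subseteq> F (Suc m)" and F_K: "\<And>m T. T \<in> F m \<Longrightarrow> apex T \<in> K"
    and approx: "\<And>m j T. \<lbrakk>T \<in> F m; m \<le> j\<rbrakk> \<Longrightarrow> norm (b j (apex T) - f (apex T)) \<le> \<eta> / 4 ^ j"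
    and net: "\<And>m x. x \<in> K \<Longrightarrow> \<exists>T\<in>F (Suc m). \<forall>j\<le>m. norm (b j x - b j (apex T)) \<le> \<eta> / 4 ^ Suc m"
    and jump: "\<And>m. \<exists>T\<in>F (Suc m). \<exists>S\<in>F (Suc m). \<delta> \<le> norm (f (apex T) - f (apex S))
      \<and> (\<forall>j\<le>m. norm (b j (apex T) - b j (apex S)) \<le> \<eta> / 4 ^ Suc m)"
    and child: "\<And>m t ch. Node t ch \<in> F m \<Longrightarrow> \<exists>n. ch n \<in> F (Suc m)
      \<and> (\<forall>j\<le>m. norm (b j (apex (ch n)) - b j t) \<le> \<eta> / 4 ^ Suc m)"
    and Tr: "\<And>m. Tr m \<in> F m" "\<And>m. admissible K (\<lambda>x. Re (w * f x)) (Tr m) False (real m)"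
    and w: "norm w = 1" and p: "p \<in> K" and lower: "\<And>j. \<beta> \<le> norm (b j p)"
    and pos: "0 < \<beta>" "0 < \<delta>" "0 < \<eta>"
    and small: "2 * \<eta> / \<beta> * (5 * M / \<delta> + 3) \<le> 1 / 2"
begin

lemma F_mono: "m \<le> n \<Longrightarrow> F m \<subseteq> F n"
  using lift_Suc_mono_le[of F] F_Suc by blast

lemma M_nonneg: "0 \<le> M"
  using order_trans[OF norm_ge_zero M[OF p]] .

lemma coefficient_le:
  assumes "\<And>m. m \<le> n \<Longrightarrow> norm (psum b c m p) \<le> Q" "j < n"
  shows "norm (c j) \<le> 2 / \<beta> * Q"
proof -
  have "norm (c j) * \<beta> \<le> 2 * Q"
    using assms by (intro coefficient_bound[where p = p and b = b] lower) auto
  then show ?thesis using pos(1) by (simp add: field_simps)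
qed

text \<open>There are \<open>m\<close> terms with an error of \<open>\<eta> / 4 ^ m\<close> each,
  and \<open>m \<le> 4 ^ m\<close>.\<close>

lemma head_le:
  assumes c: "\<And>j. j < m \<Longrightarrow> norm (c j) \<le> R" and R: "0 \<le> R"
    and xy: "\<And>j. j < m \<Longrightarrow> norm (b j x - b j y) \<le> \<eta> / 4 ^ m"
  shows "norm (psum b c m x - psum b c m y) \<le> R * \<eta>"
proof -
  have "psum b c m x - psum b c m y = (\<Sum>j<m. c j * (b j x - b j y))"
    by (simp add: psum_def right_diff_distrib sum_subtractf)
  also have "norm \<dots> \<le> (\<Sum>j<m. R * (\<eta> / 4 ^ m))"
    proof (rule sum_norm_le)
    fix j assume "j \<in> {..<m}"
    then have "norm (c j) * norm (b j x - b j y) \<le> R * (\<eta> / 4 ^ m)"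
      using R by (intro mult_mono c xy) auto
    then show "norm (c j * (b j x - b j y)) \<le> R * (\<eta> / 4 ^ m)"
      by (simp only: norm_mult)
  qed
  also have "\<dots> = R * \<eta> * (real m / 4 ^ m)" by simp
  also have "\<dots> \<le> R * \<eta> * 1"
  proof (rule mult_left_mono)
    have "m < 2 ^ m" by (rule less_exp)
    also have "(2::nat) ^ m \<le> 4 ^ m" by (intro power_mono) auto
    finally have "real m \<le> 4 ^ m" using of_nat_le_iff[of m "4 ^ m", where ?'a = real] by simp
    then show "real m / 4 ^ m \<le> 1" by simp
  qed (use R pos in simp)
  finally show ?thesis by simp
qed

lemma block_le:
  assumes c: "\<And>j. j < n \<Longrightarrow> norm (c j) \<le> R" and "m \<le> n"
    and x: "\<And>j. \<lbrakk>m \<le> j; j < n\<rbrakk> \<Longrightarrow> norm (b j x - z) \<le> e j"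
  shows "norm (psum b c n x - psum b c m x - (\<Sum>j=m..<n. c j) * z) \<le> (\<Sum>j=m..<n. R * e j)"
proof -
  have "psum b c n x - psum b c m x - (\<Sum>j=m..<n. c j) * z = (\<Sum>j=m..<n. c j * (b j x - z))"
    using psum_split[OF assms(2), of b c x]
    by (simp add: right_diff_distrib sum_subtractf sum_distrib_right)
  also have "norm \<dots> \<le> (\<Sum>j=m..<n. R * e j)"
  proof (rule sum_norm_le)
    fix j assume "j \<in> {m..<n}"
    then show "norm (c j * (b j x - z)) \<le> R * e j"
      unfolding norm_mult using c[of j] x[of j] order_trans[OF norm_ge_zero c[of j]]
      by (intro mult_mono) auto
  qed
  finally show ?thesis .
qed

text \<open>From stage \<open>m\<close> on the terms are close to \<open>f\<close> at the root of an
  active tree, and the errors \<open>\<eta> / 4 ^ j\<close> add up to at most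
  \<open>2 * \<eta>\<close>.\<close>

lemma tail_le:
  assumes c: "\<And>j. j < n \<Longrightarrow> norm (c j) \<le> R" and R: "0 \<le> R" and "m \<le> n" "T \<in> F m"
  shows "norm (psum b c n (apex T) - psum b c m (apex T) - (\<Sum>j=m..<n. c j) * f (apex T)) \<le> 2 * R * \<eta>"
proof -
  have "norm (psum b c n (apex T) - psum b c m (apex T) - (\<Sum>j=m..<n. c j) * f (apex T))
      \<le> (\<Sum>j=m..<n. R * (\<eta> / 4 ^ j))"
    using c assms(3) approx[OF assms(4)] by (rule block_le)
  also have "\<dots> \<le> R * (2 * \<eta>)"
    unfolding sum_distrib_left[symmetric]
    using R pos(3) sum_inverse_power4_le by (intro mult_left_mono) auto
  finally show ?thesis by simp
qed

text \<open>At the two roots of a jump pair the terms before \<open>Suc m\<close> nearly agree, and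
  the later ones are close to two values of \<open>f\<close> at distance at least
  \<open>\<delta>\<close>. Subtracting the partial sums isolates the coefficient sum times the jump.
  Of the five error units \<open>R * \<eta>\<close>, one comes from the heads and two from each
  tail.\<close>

lemma coefficient_sum_le:
  assumes c: "\<And>j. j < n \<Longrightarrow> norm (c j) \<le> R" and R: "0 \<le> R" and n: "Suc m \<le> n"
    and Z: "\<And>x. x \<in> K \<Longrightarrow> norm (psum b c n x) \<le> Z"
  shows "norm (\<Sum>j=Suc m..<n. c j) \<le> (2 * Z + 5 * R * \<eta>) / \<delta>"
proof -
  obtain T S where TS: "T \<in> F (Suc m)" "S \<in> F (Suc m)" "\<delta> \<le> norm (f (apex T) - f (apex S))"
      "\<And>j. j \<le> m \<Longrightarrow> norm (b j (apex T) - b j (apex S)) \<le> \<eta> / 4 ^ Suc m"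
    using jump[of m] by blast
  define \<sigma> where "\<sigma> = (\<Sum>j=Suc m..<n. c j)"
  have "norm \<sigma> * \<delta> \<le> norm (\<sigma> * f (apex T) - \<sigma> * f (apex S))"
    using TS(3) by (simp add: norm_mult mult_left_mono flip: right_diff_distrib)
  also have "\<dots> \<le> 2 * Z + 5 * R * \<eta>"
  proof -
    have "norm (psum b c (Suc m) (apex T) - psum b c (Suc m) (apex S)) \<le> R * \<eta>"
      using c n R TS(4) by (intro head_le) auto
    moreover have "norm (psum b c n (apex T) - psum b c (Suc m) (apex T) - \<sigma> * f (apex T)) \<le> 2 * R * \<eta>"
      unfolding \<sigma>_def by (rule tail_le[OF c R n TS(1)])
    moreover have "norm (psum b c n (apex S) - psum b c (Suc m) (apex S) - \<sigma> * f (apex S)) \<le> 2 * R * \<eta>"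
      unfolding \<sigma>_def by (rule tail_le[OF c R n TS(2)])
    moreover have "norm (psum b c n (apex T)) \<le> Z" "norm (psum b c n (apex S)) \<le> Z"
      using Z F_K TS by auto
    moreover have "norm (\<sigma> * f (apex T) - \<sigma> * f (apex S))
        \<le> norm (psum b c n (apex T)) + norm (psum b c n (apex S))
          + norm (psum b c (Suc m) (apex T) - psum b c (Suc m) (apex S))
          + norm (psum b c n (apex T) - psum b c (Suc m) (apex T) - \<sigma> * f (apex T))
          + norm (psum b c n (apex S) - psum b c (Suc m) (apex S) - \<sigma> * f (apex S))"
      by norm
    ultimately show ?thesis by linarith
  qed
  finally show ?thesis using pos(2) by (simp add: \<sigma>_def pos_le_divide_eq)
qed

text \<open>An absorption argument: \<open>Q\<close>, the largest norm of a partial sum up to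
  \<open>n\<close>, bounds the coefficients, and each partial sum is then at most a constant times
  \<open>Z\<close> plus \<open>Q / 2\<close>. Hence \<open>Q\<close> is at most twice that constant
  times \<open>Z\<close>.\<close>

lemma Grunblum:
  assumes mn: "m \<le> n" and Z: "\<And>x. x \<in> K \<Longrightarrow> norm (psum b c n x) \<le> Z" and x: "x \<in> K"
  shows "norm (psum b c m x) \<le> 2 * (1 + 2 * M / \<delta>) * Z"
proof -
  define Q where "Q = Max ((\<lambda>m. supn K (psum b c m)) ` {..n})"
  have Q: "norm (psum b c k y) \<le> Q" if "k \<le> n" "y \<in> K" for k y
  proof -
    have "norm (psum b c k y) \<le> supn K (psum b c k)"
      by (intro norm_le_supn compact continuous_on_psum cont that)
    also have "\<dots> \<le> Q" unfolding Q_def using that by (intro Max_ge) auto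
    finally show ?thesis .
  qed
  define R where "R = 2 / \<beta> * Q"
  have c: "norm (c j) \<le> R" if "j < n" for j
    unfolding R_def using Q p that by (intro coefficient_le) auto
  have Q0: "0 \<le> Q" using order_trans[OF norm_ge_zero Q[OF mn x]] .
  then have R: "0 \<le> R" using pos by (simp add: R_def)
  have Z0: "0 \<le> Z" using order_trans[OF norm_ge_zero Z[OF x]] .
  have step: "norm (psum b c k y) \<le> (1 + 2 * M / \<delta>) * Z + Q / 2" if k: "k \<le> n" and y: "y \<in> K" for k y
  proof (cases k)
    case 0
    then show ?thesis using Q0 Z0 M_nonneg pos by (simp add: psum_def)
  next
    case (Suc m)
    \<comment> \<open>The point \<open>y\<close> is replaced by the root of an active tree. There
      the partial sums up to \<open>k\<close> and up to \<open>n\<close> differ by about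
      \<open>\<sigma> * f (apex T)\<close>.\<close>
    obtain T where T: "T \<in> F k" "\<And>j. j \<le> m \<Longrightarrow> norm (b j y - b j (apex T)) \<le> \<eta> / 4 ^ k"
      using net[OF y, of m] Suc by blast
    define \<sigma> where "\<sigma> = (\<Sum>j=k..<n. c j)"
    have "norm \<sigma> \<le> (2 * Z + 5 * R * \<eta>) / \<delta>"
      unfolding \<sigma>_def Suc using c R Z k Suc by (intro coefficient_sum_le) auto
    then have "norm \<sigma> * norm (f (apex T)) \<le> (2 * Z + 5 * R * \<eta>) / \<delta> * M"
      using M F_K[OF T(1)] R Z0 pos by (intro mult_mono) auto
    moreover have "norm (psum b c k y - psum b c k (apex T)) \<le> R * \<eta>"
      using c k R T(2) Suc by (intro head_le) auto
    moreover have "norm (psum b c n (apex T) - psum b c k (apex T) - \<sigma> * f (apex T)) \<le> 2 * R * \<eta>"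
      unfolding \<sigma>_def by (rule tail_le[OF c R k T(1)])
    moreover have "norm (psum b c n (apex T)) \<le> Z" using Z F_K T by blast
    moreover have "norm (psum b c k y) \<le> norm (psum b c k y - psum b c k (apex T))
        + norm (psum b c n (apex T) - psum b c k (apex T) - \<sigma> * f (apex T))
        + norm (psum b c n (apex T)) + norm (\<sigma> * f (apex T))"
      by norm
    ultimately have "norm (psum b c k y) \<le> Z + (2 * Z + 5 * R * \<eta>) / \<delta> * M + 3 * R * \<eta>"
      unfolding norm_mult by linarith
    \<comment> \<open>The coefficient of \<open>Q\<close> is the quantity that \<open>small\<close>
      bounds by one half.\<close>
    also have "\<dots> = (1 + 2 * M / \<delta>) * Z + 2 * \<eta> / \<beta> * (5 * M / \<delta> + 3) * Q"
      using pos by (simp add: R_def field_simps)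
    also have "\<dots> \<le> (1 + 2 * M / \<delta>) * Z + 1 / 2 * Q"
      using small Q0 by (intro add_left_mono mult_right_mono)
    finally show ?thesis by simp
  qed
  have "Q \<le> (1 + 2 * M / \<delta>) * Z + Q / 2"
    unfolding Q_def
  proof (rule Max.boundedI)
    fix a assume "a \<in> (\<lambda>m. supn K (psum b c m)) ` {..n}"
    then obtain k where "k \<le> n" "a = supn K (psum b c k)" by auto
    then show "a \<le> (1 + 2 * M / \<delta>) * Z + Max ((\<lambda>m. supn K (psum b c m)) ` {..n}) / 2"
      using step Q0 Z0 M_nonneg pos unfolding Q_def by (auto intro!: supn_le)
  qed auto
  then show ?thesis using Q[OF mn x] unfolding mult.assoc[of 2] by linarith
qed

section \<open>Growth of partial sums along a tree\<close>

text \<open>The block from \<open>q i\<close> to \<open>q (Suc i)\<close> contributes about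
  \<open>D\<close> or \<open>- D\<close> times \<open>f\<close> at the point reached at time
  \<open>q i\<close>. A free move (even \<open>i\<close>) followed by a counted one (odd
  \<open>i\<close>) thus contributes \<open>- D\<close> times the counted increment, and
  \<open>\<Gamma>\<close> sums these increments of \<open>f\<close>. For odd \<open>i\<close> the
  pair is half done, whence the extra \<open>D * f (apex T)\<close>. The tree is active at
  \<open>q i - 1\<close>, so that its child is active at \<open>q i\<close>, in time for the block.
  The term \<open>2 * M / 2 ^ i\<close> adds up the deviations of the coefficient sums from
  \<open>D\<close> and \<open>- D\<close>.\<close>

lemma tree_growth:
  assumes c: "\<And>j. norm (c j) \<le> R" and R: "0 \<le> R" and q: "strict_mono q" "1 \<le> q 0"
    and D: "\<And>i. norm (sum c {q i..<q (Suc i)} - (if odd i then - D else D)) \<le> 1 / 2 ^ i"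
  shows "\<lbrakk>admissible K (\<lambda>x. Re (w * f x)) T (odd i) l; T \<in> F (q i - 1)\<rbrakk> \<Longrightarrow>
    \<exists>x\<in>K. \<exists>n\<ge>q i. \<exists>\<Gamma>. l \<le> Re (w * \<Gamma>) \<and>
      (\<forall>j<q i. norm (b j x - b j (apex T)) \<le> 2 * \<eta> / 4 ^ q i) \<and>
      norm (psum b c n x - psum b c (q i) x + D * \<Gamma> + (if odd i then D * f (apex T) else 0))
        \<le> (\<Sum>j=q i..<n. R * (2 * \<eta> / 4 ^ j)) + 2 * M / 2 ^ i"
proof (induction T arbitrary: i l)
  case (Leaf t)
  \<comment> \<open>A leaf is admissible only when a free move is due, so \<open>i\<close> is even
    and no pair is open; the remaining sum is empty and \<open>\<Gamma>\<close> is 0.\<close>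
  then show ?case
    using M_nonneg pos(3) by (intro bexI[of _ t] exI[of _ "q i"] conjI exI[of _ 0]) auto
next
  case (Node t ch)
  have qi: "1 \<le> q i" "q i < q (Suc i)"
    using q(2) strict_mono_less_eq[OF q(1), of 0 i] strict_mono_less[OF q(1), of i "Suc i"] by auto
  obtain k where k: "ch k \<in> F (Suc (q i - 1))"
      "\<And>j. j \<le> q i - 1 \<Longrightarrow> norm (b j (apex (ch k)) - b j t) \<le> \<eta> / 4 ^ Suc (q i - 1)"
    using child[OF Node.prems(2)] by blast
  define s where "s = apex (ch k)"
  have F: "ch k \<in> F (q i)" and st: "\<And>j. j < q i \<Longrightarrow> norm (b j s - b j t) \<le> \<eta> / 4 ^ q i"
    using k qi by (auto simp: s_def)
  \<comment> \<open>The chosen child stays active until the next move is due.\<close>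
  have F': "ch k \<in> F (q (Suc i) - 1)"
  proof (rule subsetD[OF F_mono F])
    show "q i \<le> q (Suc i) - 1" using qi(2) by simp
  qed
  define g where "g = (\<lambda>x. Re (w * f x))"
  define l' where "l' = (if odd i then l - (g s - g t) else l)"
  have "admissible K g (ch k) (\<not> odd i) l'"
    using Node.prems(1) unfolding g_def[symmetric] l'_def s_def admissible.simps by blast
  then have "admissible K (\<lambda>x. Re (w * f x)) (ch k) (odd (Suc i)) l'"
    unfolding g_def by simp
  from Node.IH[OF rangeI this F'] obtain x n \<Gamma>' where x: "x \<in> K" and n: "q (Suc i) \<le> n"
    and \<Gamma>': "l' \<le> Re (w * \<Gamma>')"
    and xs: "\<And>j. j < q (Suc i) \<Longrightarrow> norm (b j x - b j s) \<le> 2 * \<eta> / 4 ^ q (Suc i)"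
    and gr: "norm (psum b c n x - psum b c (q (Suc i)) x + D * \<Gamma>' + (if odd (Suc i) then D * f s else 0))
        \<le> (\<Sum>j=q (Suc i)..<n. R * (2 * \<eta> / 4 ^ j)) + 2 * M / 2 ^ Suc i"
    unfolding s_def by blast
  \<comment> \<open>The factor 4 between consecutive powers absorbs the doubled tolerance, so all
    later moves together cost at most one further \<open>\<eta> / 4 ^ j\<close>.\<close>
  have e4: "2 * \<eta> / 4 ^ q (Suc i) \<le> \<eta> / 4 ^ j" if "j < q (Suc i)" for j
  proof -
    have "(4::real) ^ Suc j \<le> 4 ^ q (Suc i)" using that by (intro power_increasing) auto
    then have "2 * \<eta> / 4 ^ q (Suc i) \<le> 2 * \<eta> / 4 ^ Suc j"
      using pos(3) by (intro divide_left_mono) auto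
    also have "\<dots> \<le> \<eta> / 4 ^ j" using pos(3) by (simp add: field_simps)
    finally show ?thesis .
  qed
  define \<Gamma> where "\<Gamma> = (if odd i then \<Gamma>' + f s - f t else \<Gamma>')"
  have "l \<le> Re (w * \<Gamma>)"
    using \<Gamma>' by (auto simp: \<Gamma>_def l'_def g_def algebra_simps split: if_splits)
  moreover have "norm (b j x - b j t) \<le> 2 * \<eta> / 4 ^ q i" if j: "j < q i" for j
  proof -
    have "norm (b j x - b j t) \<le> norm (b j x - b j s) + norm (b j s - b j t)" by norm
    also have "\<dots> \<le> \<eta> / 4 ^ q i + \<eta> / 4 ^ q i"
      using xs[of j] e4[OF qi(2)] st[OF j] j qi by simp
    finally show ?thesis by simp
  qed
  moreover have "norm (psum b c n x - psum b c (q i) x + D * \<Gamma> + (if odd i then D * f t else 0))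
        \<le> (\<Sum>j=q i..<n. R * (2 * \<eta> / 4 ^ j)) + 2 * M / 2 ^ i"
  proof -
    define \<tau> where "\<tau> = sum c {q i..<q (Suc i)}"
    \<comment> \<open>\<open>u\<close> is the error of replacing the terms by \<open>f s\<close> on
      the block, \<open>v\<close> that of replacing the coefficient sum by \<open>D\<close> or
      \<open>- D\<close>, and \<open>y\<close> is the quantity in the induction hypothesis.\<close>
    define u where "u = psum b c (q (Suc i)) x - psum b c (q i) x - \<tau> * f s"
    define v where "v = (\<tau> - (if odd i then - D else D)) * f s"
    define y where "y = psum b c n x - psum b c (q (Suc i)) x + D * \<Gamma>' + (if odd (Suc i) then D * f s else 0)"
    have "norm u \<le> (\<Sum>j=q i..<q (Suc i). R * (2 * \<eta> / 4 ^ j))"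
      unfolding u_def \<tau>_def
    proof (rule block_le)
      fix j assume j: "q i \<le> j" "j < q (Suc i)"
      have "norm (b j x - f s) \<le> norm (b j x - b j s) + norm (b j s - f s)" by norm
      also have "\<dots> \<le> \<eta> / 4 ^ j + \<eta> / 4 ^ j"
        using xs[OF j(2)] e4[OF j(2)] approx[OF F j(1)] by (simp add: s_def)
      finally show "norm (b j x - f s) \<le> 2 * \<eta> / 4 ^ j" by simp
    qed (use c qi in auto)
    moreover have "norm v \<le> 1 / 2 ^ i * M"
      unfolding v_def norm_mult \<tau>_def using M F_K[OF F] by (intro mult_mono D) (auto simp: s_def)
    moreover have "norm y \<le> (\<Sum>j=q (Suc i)..<n. R * (2 * \<eta> / 4 ^ j)) + 2 * M / 2 ^ Suc i"
      unfolding y_def by (rule gr)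
    moreover have "psum b c n x - psum b c (q i) x + D * \<Gamma> + (if odd i then D * f t else 0) = y + u + v"
      by (simp add: y_def u_def v_def \<Gamma>_def algebra_simps)
    moreover have "(\<Sum>j=q i..<q (Suc i). R * (2 * \<eta> / 4 ^ j)) + (\<Sum>j=q (Suc i)..<n. R * (2 * \<eta> / 4 ^ j))
        = (\<Sum>j=q i..<n. R * (2 * \<eta> / 4 ^ j))"
      using qi n by (intro sum.atLeastLessThan_concat) auto
    moreover have "1 / 2 ^ i * M + 2 * M / 2 ^ Suc i = 2 * M / 2 ^ i" by simp
    ultimately show ?thesis
      using norm_triangle_ineq[of "y + u" v] norm_triangle_ineq[of y u] by simp
  qed
  ultimately show ?case
    using x n qi by (intro bexI[of _ x] exI[of _ n] conjI exI[of _ \<Gamma>]) auto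
qed

text \<open>If the sums of coefficients diverge, they oscillate by a fixed \<open>D\<close>. A tree
  with increments of at least \<open>m\<close> then gives two partial sums that differ at some point
  by at least \<open>norm D * real m\<close> up to a constant, which exceeds \<open>2 * B\<close>
  for large \<open>m\<close>.\<close>

lemma summable_if_psum_bounded:
  assumes B: "\<And>n x. x \<in> K \<Longrightarrow> norm (psum b c n x) \<le> B"
  shows "summable c"
proof (rule ccontr)
  assume ns: "\<not> summable c"
  define \<sigma> where "\<sigma> n = sum c {..<n}" for n
  define R where "R = 2 / \<beta> * B"
  have B0: "0 \<le> B" using order_trans[OF norm_ge_zero B[OF p]] .
  then have R: "0 \<le> R" using pos by (simp add: R_def)
  have c: "norm (c j) \<le> R" for j
    unfolding R_def by (rule coefficient_le[of "Suc j"]) (use B p in auto)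
  have \<sigma>_diff: "sum c {m..<n} = \<sigma> n - \<sigma> m" if "m \<le> n" for m n
    using sum.atLeastLessThan_concat[of 0 m n c] that
    by (simp add: \<sigma>_def lessThan_atLeast0 eq_diff_eq add.commute)
  have "bounded (range \<sigma>)"
  proof (rule boundedI)
    fix y assume "y \<in> range \<sigma>"
    then obtain n where y: "y = \<sigma> n" by blast
    \<comment> \<open>The jump estimate covers sums that start at a positive index;
      \<open>c 0\<close> is bounded separately by \<open>R\<close>.\<close>
    show "norm y \<le> R + (2 * B + 5 * R * \<eta>) / \<delta>"
    proof (cases n)
      case 0
      then show ?thesis using y R B0 pos by (simp add: \<sigma>_def)
    next
      case (Suc m)
      have "norm (sum c {Suc 0..<n}) \<le> (2 * B + 5 * R * \<eta>) / \<delta>"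
        using c R B Suc by (intro coefficient_sum_le) auto
      moreover have "y = c 0 + sum c {Suc 0..<n}"
        using \<sigma>_diff[of "Suc 0" n] Suc y by (simp add: \<sigma>_def)
      ultimately show ?thesis using c[of 0] norm_triangle_ineq[of "c 0" "sum c {Suc 0..<n}"] by simp
    qed
  qed
  moreover have "\<not> convergent \<sigma>" using ns by (simp add: summable_iff_convergent \<sigma>_def[abs_def])
  ultimately obtain D where D: "D \<noteq> 0" "\<And>N. \<exists>q. strict_mono q \<and> N \<le> q 0 \<and>
      (\<forall>i. norm (\<sigma> (q (Suc i)) - \<sigma> (q i) - (if odd i then - D else D)) \<le> 1 / 2 ^ i)"
    using alternating_subsequence by blast
  \<comment> \<open>\<open>2 * B\<close> accounts for two partial sums, the rest for the error in
    \<open>tree_growth\<close> at \<open>i = 0\<close>.\<close>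
  define H where "H = 2 * B + 4 * R * \<eta> + 2 * M"
  obtain m where "H / norm D < real m" using reals_Archimedean2 by blast
  then have m: "H < norm D * real m" using D(1) by (simp add: pos_divide_less_eq mult.commute)
  \<comment> \<open>The times start after \<open>m\<close>, so that \<open>Tr m\<close> is already
    active at \<open>q 0 - 1\<close>.\<close>
  obtain q where q: "strict_mono q" "Suc m \<le> q 0"
      "\<And>i. norm (\<sigma> (q (Suc i)) - \<sigma> (q i) - (if odd i then - D else D)) \<le> 1 / 2 ^ i"
    using D(2)[of "Suc m"] by blast
  have inc: "norm (sum c {q i..<q (Suc i)} - (if odd i then - D else D)) \<le> 1 / 2 ^ i" for i
    using q(3)[of i] \<sigma>_diff[of "q i" "q (Suc i)"] strict_mono_less_eq[OF q(1), of i "Suc i"] by simp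
  have TrF: "Tr m \<in> F (q 0 - 1)"
  proof (rule subsetD[OF F_mono Tr(1)])
    show "m \<le> q 0 - 1" using q(2) by simp
  qed
  have adm: "admissible K (\<lambda>x. Re (w * f x)) (Tr m) (odd 0) (real m)"
    using Tr(2) by simp
  have "1 \<le> q 0" using q(2) by simp
  from tree_growth[where c = c, OF c R q(1) this inc adm TrF] obtain x n \<Gamma> where x: "x \<in> K" and \<Gamma>: "real m \<le> Re (w * \<Gamma>)"
    and gr: "norm (psum b c n x - psum b c (q 0) x + D * \<Gamma>)
        \<le> (\<Sum>j=q 0..<n. R * (2 * \<eta> / 4 ^ j)) + 2 * M"
    by auto
  have "real m \<le> norm \<Gamma>"
    using \<Gamma> complex_Re_le_cmod[of "w * \<Gamma>"] w by (simp add: norm_mult)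
  then have "norm D * real m \<le> norm (D * \<Gamma>)"
    by (simp add: norm_mult mult_left_mono)
  moreover have "norm (D * \<Gamma>) \<le> norm (psum b c n x - psum b c (q 0) x + D * \<Gamma>)
      + norm (psum b c n x) + norm (psum b c (q 0) x)"
    by norm
  moreover have "(\<Sum>j=q 0..<n. R * (2 * \<eta> / 4 ^ j)) \<le> R * (2 * (2 * \<eta>))"
    unfolding sum_distrib_left[symmetric] using R pos(3)
    by (intro mult_left_mono sum_inverse_power4_le) simp_all
  ultimately show False
    using gr B[OF x, of n] B[OF x, of "q 0"] m by (simp add: H_def)
qed

lemma basic_seq: "basic_seq K b"
  using Grunblum_basic_seq[OF compact cont p pos(1) lower _ Grunblum] M_nonneg pos by simp

end

section \<open>Existence of the strongly summing subsequence\<close>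

theorem theorem2p2:
  fixes K :: "'a::metric_space set"
    and fs :: "nat \<Rightarrow> 'a \<Rightarrow> complex"
    and f :: "'a \<Rightarrow> complex"
  assumes "compact K"
    and "\<And>n. continuous_on K (fs n)"
    and "\<exists>M. \<forall>n. \<forall>x\<in>K. norm (fs n x) \<le> M"
    and "\<And>x. x \<in> K \<Longrightarrow> (\<lambda>n. fs n x) \<longlonglongrightarrow> f x"
    and "\<not> inD K f"
  shows "\<exists>r. strict_mono r \<and> strongly_summing K (fs \<circ> r)"
proof -
  obtain M where fsM: "\<And>n x. x \<in> K \<Longrightarrow> norm (fs n x) \<le> M"
    using assms(3) by blast
  have fM: "norm (f x) \<le> M" if "x \<in> K" for x
    by (rule LIMSEQ_le_const2[OF tendsto_norm[OF assms(4)[OF that]]]) (use fsM[OF that] in blast)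
  have nc: "\<not> continuous_on K f"
    using fM assms(5) by (rule not_inD_imp_not_continuous)
  then have "\<exists>t\<in>K. \<exists>\<delta>>0. \<forall>d>0. \<exists>s\<in>K. dist s t < d \<and> \<delta> \<le> dist (f s) (f t)"
    unfolding continuous_on_iff by (meson not_less)
  then obtain t \<delta> where t: "t \<in> K" and \<delta>: "0 < \<delta>"
    and jump: "\<And>d. 0 < d \<Longrightarrow> \<exists>s\<in>K. dist s t < d \<and> \<delta> \<le> dist (f s) (f t)"
    by blast
  \<comment> \<open>Otherwise \<open>f\<close> would agree with zero on \<open>K\<close> and be
    continuous there.\<close>
  have "\<exists>p\<in>K. f p \<noteq> 0"
    using nc continuous_on_eq[of K "\<lambda>_. 0" f] continuous_on_const[of K 0] by metis
  then obtain p where p: "p \<in> K" "f p \<noteq> 0" by blast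
  \<comment> \<open>At \<open>p\<close> all terms from some \<open>N0\<close> on exceed half of the
    limit in norm; the selection starts beyond \<open>N0\<close>, so this holds for the whole
    subsequence.\<close>
  define \<beta> where "\<beta> = norm (f p) / 2"
  have \<beta>: "0 < \<beta>" "\<beta> < norm (f p)" using p(2) by (simp_all add: \<beta>_def)
  have "\<forall>\<^sub>F k in sequentially. \<beta> < norm (fs k p)"
    using tendsto_norm[OF assms(4)[OF p(1)]] \<beta>(2) by (rule order_tendstoD)
  then obtain N0 where N0: "\<And>k. k \<ge> N0 \<Longrightarrow> \<beta> < norm (fs k p)"
    by (auto simp: eventually_sequentially)
  obtain w where w: "norm w = 1" "\<forall>L. \<exists>T. admissible K (\<lambda>x. Re (w * f x)) T False L"
    using not_inD_imp_unbounded_trees[OF fM assms(5)] by blast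
  then have "\<forall>m. \<exists>T. admissible K (\<lambda>x. Re (w * f x)) T False (real m)" by blast
  from choice[OF this] obtain Tr
    where Tr: "\<And>m. admissible K (\<lambda>x. Re (w * f x)) (Tr m) False (real m)"
    by blast
  have M: "0 \<le> M" using order_trans[OF norm_ge_zero fM[OF p(1)]] .
  \<comment> \<open>\<open>a\<close> is the bracket in \<open>small\<close>, and
    \<open>\<eta>\<close> is the value for which \<open>small\<close> holds with equality.\<close>
  define a where "a = 5 * M / \<delta> + 3"
  have a: "0 < a" using M \<delta> by (simp add: a_def add_nonneg_pos)
  define \<eta> where "\<eta> = \<beta> / (4 * a)"
  have \<eta>: "0 < \<eta>" using \<beta> a by (simp add: \<eta>_def)
  have small: "2 * \<eta> / \<beta> * (5 * M / \<delta> + 3) \<le> 1 / 2"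
    unfolding a_def[symmetric] using \<beta> a by (simp add: \<eta>_def)
  have Tr': "\<exists>p l. admissible K (\<lambda>x. Re (w * f x)) (Tr m) p l" for m
    using Tr by blast
  show ?thesis
  proof (rule selection[of K fs f \<eta> "\<lambda>x. Re (w * f x)" Tr t \<delta> N0, OF assms(1,2,4) \<eta> Tr' t jump])
    fix r F
    assume r: "strict_mono r" "N0 \<le> r 0"
      and F: "\<And>m. F m \<subseteq> F (Suc m)" "\<And>m. Tr m \<in> F m"
        "\<And>m T. T \<in> F m \<Longrightarrow> \<exists>p l. admissible K (\<lambda>x. Re (w * f x)) T p l"
        "\<And>m T j. \<lbrakk>T \<in> F m; m \<le> j\<rbrakk> \<Longrightarrow> dist (fs (r j) (apex T)) (f (apex T)) < \<eta> / 4 ^ j"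
        "\<And>m x. x \<in> K \<Longrightarrow> \<exists>T\<in>F (Suc m). \<forall>j\<le>m. dist (fs (r j) x) (fs (r j) (apex T)) < \<eta> / 4 ^ Suc m"
        "\<And>m. \<exists>T\<in>F (Suc m). \<exists>S\<in>F (Suc m). \<delta> \<le> dist (f (apex T)) (f (apex S))
          \<and> (\<forall>j\<le>m. dist (fs (r j) (apex T)) (fs (r j) (apex S)) < \<eta> / 4 ^ Suc m)"
        "\<And>m u ch. Node u ch \<in> F m \<Longrightarrow> \<exists>n. ch n \<in> F (Suc m)
          \<and> (\<forall>j\<le>m. dist (fs (r j) (apex (ch n))) (fs (r j) u) < \<eta> / 4 ^ Suc m)"
    interpret selected_sequence K f "fs \<circ> r" F Tr M \<delta> \<eta> \<beta> p w
    proof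
      show "apex T \<in> K" if "T \<in> F m" for m T
        using F(3) that admissible_apex by blast
      show "norm ((fs \<circ> r) j (apex T) - f (apex T)) \<le> \<eta> / 4 ^ j" if "T \<in> F m" "m \<le> j" for m j T
        using F(4)[OF that] by (simp add: dist_norm)
      show "\<exists>T\<in>F (Suc m). \<forall>j\<le>m. norm ((fs \<circ> r) j x - (fs \<circ> r) j (apex T)) \<le> \<eta> / 4 ^ Suc m"
        if "x \<in> K" for m x
        using F(5)[OF that, of m] unfolding dist_norm comp_def by (meson less_imp_le)
      show "\<exists>T\<in>F (Suc m). \<exists>S\<in>F (Suc m). \<delta> \<le> norm (f (apex T) - f (apex S))
        \<and> (\<forall>j\<le>m. norm ((fs \<circ> r) j (apex T) - (fs \<circ> r) j (apex S)) \<le> \<eta> / 4 ^ Suc m)" for m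
        using F(6)[of m] unfolding dist_norm comp_def by (meson less_imp_le)
      show "\<exists>n. ch n \<in> F (Suc m) \<and> (\<forall>j\<le>m. norm ((fs \<circ> r) j (apex (ch n)) - (fs \<circ> r) j u) \<le> \<eta> / 4 ^ Suc m)"
        if "Node u ch \<in> F m" for m u ch
        using F(7)[OF that] unfolding dist_norm comp_def by (meson less_imp_le)
      show "\<beta> \<le> norm ((fs \<circ> r) j p)" for j
      proof -
        have "r 0 \<le> r j" using r(1) by (simp add: strict_mono_less_eq)
        then show ?thesis using N0[of "r j"] r(2) by simp
      qed
    qed (use assms(1,2) fM F(1,2) Tr w(1) p(1) \<beta> \<delta> \<eta> small in auto)
    have "strongly_summing K (fs \<circ> r)"
      unfolding strongly_summing_def
    proof (intro conjI allI impI)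
      show "weak_Cauchy K (fs \<circ> r)"
      proof (rule weak_Cauchy_pointwise_convergent)
        show "(\<lambda>n. (fs \<circ> r) n x) \<longlonglongrightarrow> f x" if "x \<in> K" for x
          using LIMSEQ_subseq_LIMSEQ[OF assms(4)[OF that] r(1)] by (simp add: o_def)
      qed (use assms(1,2) fsM in auto)
      show "basic_seq K (fs \<circ> r)" by (rule basic_seq)
      fix c assume "\<exists>B. \<forall>n. supn K (psum (fs \<circ> r) c n) \<le> B"
      then obtain B where B: "\<And>n. supn K (psum (fs \<circ> r) c n) \<le> B" by blast
      show "summable c"
      proof (rule summable_if_psum_bounded)
        fix n x assume "x \<in> K"
        then show "norm (psum (fs \<circ> r) c n x) \<le> B"
          using norm_le_supn[OF assms(1) continuous_on_psum[of K "fs \<circ> r", OF cont]] B order_trans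
          by blast
      qed
    qed
    then show ?thesis using r(1) by blast
  qed
qed

end
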